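(* Fix $(t,x)\in[0,T]\times\mathbb R^N$ and write $\pi^{i,v}_*(u^i\mid u^{-i})=\pi^{i,v}_*(u^i;t,x,u^{-i})$, $i=1,\dots,N$, for the time-local conditional responses. Let these be positive conditional densities, twice continuously differentiable on the interior of $U^N$, and assume the interior of $U^N$ is connected and simply connected. The following are equivalent. (1) A time-local conditional equilibrium exists; equivalently, there is a positive integrable function $\psi$ such that $$\pi^{i,v}_*(u^i\mid u^{-i})=\frac{\psi(u)}{\int_U\psi(z^i,u^{-i})\,dz^i},\qquad i=1,\ldots,N.$$ (2) There are positive functions $\phi^i:U^{N-1}\to(0,\infty)$ such that the common function $\psi(u):=\pi^{i,v}_*(u^i\mid u^{-i})\,\phi^i(u^{-i})$ is independent of $i$ and satisfies $0<\int_{U^N}\psi(u)\,du<\infty$. (3) The cross-partial identities $$\frac{\partial^2}{\partial u^j\partial u^i}\log\pi^{i,v}_*(u^i\mid u^{-i})=\frac{\partial^2}{\partial u^i\partial u^j}\log\pi^{j,v}_*(u^j\mid u^{-j}),\qquad i\ne j,$$ hold, and a potential $\Phi$ (that is, $d\Phi=\omega$) of the closed one-form $$\omega:=\sum_{i=1}^N\partial_{u^i}\log\pi^{i,v}_*(u^i\mid u^{-i})\,du^i$$ is normalizable: $0<\int_{U^N}e^{\Phi(u)}\,du<\infty$. When these conditions hold, the joint density is unique.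
   Context: Setting. $N\in\mathbb N$ is the number of players, $T>0$ the horizon, $U\subset\mathbb R$ the (scalar) action set. For $u=(u^1,\dots,u^N)\in U^N$, $u^{-i}\in U^{N-1}$ is $u$ with coordinate $u^i$ deleted, and $(u^i,u^{-i})$ stands for $u$. Data: measurable $b^k,\sigma^k:[0,T]\times\mathbb R^N\times U^N\to\mathbb R$, running rewards $f^i:[0,T]\times\mathbb R^N\times U\to\mathbb R$, terminal rewards $g^i:\mathbb R^N\to\mathbb R$, discount rates $\beta^i\ge0$, exploration weights $\gamma^i>0$. Hamiltonian: for $p\in\mathbb R^N$ and a symmetric matrix $A$, $$H^i(t,x,u,p,A)=\sum_{k=1}^N\big[b^k(t,x,u)p^k+\tfrac12\sigma^k(t,x,u)^2A^{k,k}\big]+f^i(t,x,u^i).$$ Continuation assessment: for fixed $u^{-i}\in U^{N-1}$, let $v^i(t,x;u^{-i})=\tilde V^i(t,x;u^{-i})$ be the value function of player $i$'s entropy-regularized single-agent control problem in which the opponents' actions are frozen at $u^{-i}$ on the whole remaining horizon. It is a classical ($C^{1,2}$ in $(t,x)$) solution of $$0=\partial_t\tilde V^i-\beta^i\tilde V^i+\gamma^i\log\int_U\exp\Big\{\tfrac1{\gamma^i}H^i(t,x,u^i,u^{-i},\partial_x\tilde V^i,\partial_x^2\tilde V^i)\Big\}du^i,\qquad \tilde V^i(T,x;u^{-i})=g^i(x).$$ Local Hamiltonian: $H_v^i(t,x,u):=H^i\big(t,x,u,\partial_xv^i(t,x;u^{-i}),\partial_x^2v^i(t,x;u^{-i})\big)$.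 Time-local conditional response of player $i$: $$\pi^{i,v}_*(u^i;t,x,u^{-i}):=\frac{\exp\{H_v^i(t,x,u^i,u^{-i})/\gamma^i\}}{\int_U\exp\{H_v^i(t,x,z^i,u^{-i})/\gamma^i\}\,dz^i}$$ (defined when the denominator is finite). Time-local conditional equilibrium at $(t,x)$: a positive joint probability density $\psi^v(\cdot;t,x)$ on $U^N$ whose full conditional densities satisfy, for every $i$, $\psi^v(u^i\mid u^{-i};t,x)=\pi^{i,v}_*(u^i;t,x,u^{-i})$ for a.e. $u^{-i}$.
   Formalization: U is assumed nonempty, Borel and to differ from its interior by a null set (else the integral of e^Φ over U^N is undefined); the identities in (1) and (2) are required on the interior of U^N, as they can fail at boundary points; uniqueness is almost everywhere. *)

theory Defs
  imports "HOL-Analysis.Analysis"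
begin

text \<open>
  Players are the elements of a finite type \<open>'n\<close>, so that \<open>N = CARD('n) \<ge> 1\<close>. An action profile
  is a vector of type \<open>real ^ 'n\<close>; an opponents' profile \<open>u\<^sup>-\<^sup>i\<close> is an extensional function
  on \<open>- {i}\<close>, so that a function of \<open>u\<^sup>-\<^sup>i\<close> has no access to coordinate \<open>i\<close>.
\<close>

definition profiles :: "real set \<Rightarrow> (real ^ 'n::finite) set" where
  "profiles U = {u. \<forall>i. u $ i \<in> U}"

definition opp_profiles :: "real set \<Rightarrow> 'n::finite \<Rightarrow> ('n \<Rightarrow> real) set" where
  "opp_profiles U i = (\<Pi>\<^sub>E j\<in>- {i}. U)"

definition opp :: "'n::finite \<Rightarrow> real ^ 'n \<Rightarrow> 'n \<Rightarrow> real" where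
  "opp i u = (\<lambda>j\<in>- {i}. u $ j)"

definition join :: "'n::finite \<Rightarrow> real \<Rightarrow> ('n \<Rightarrow> real) \<Rightarrow> real ^ 'n" where
  "join i a w = (\<chi> j. if j = i then a else w j)"

definition partial_deriv :: "'n::finite \<Rightarrow> (real ^ 'n \<Rightarrow> real) \<Rightarrow> real ^ 'n \<Rightarrow> real" where
  "partial_deriv k F x = deriv (\<lambda>s. F (x + s *\<^sub>R axis k 1)) 0"

definition grad :: "(real ^ 'n::finite \<Rightarrow> real) \<Rightarrow> real ^ 'n \<Rightarrow> real ^ 'n" where
  "grad F x = (\<chi> k. partial_deriv k F x)"

definition hessian :: "(real ^ 'n::finite \<Rightarrow> real) \<Rightarrow> real ^ 'n \<Rightarrow> real ^ 'n ^ 'n" where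
  "hessian F x = (\<chi> k l. partial_deriv l (partial_deriv k F) x)"

definition C2_on :: "(real ^ 'n::finite) set \<Rightarrow> (real ^ 'n \<Rightarrow> real) \<Rightarrow> bool" where
  "C2_on S F \<longleftrightarrow>
    (\<exists>(F' :: real ^ 'n \<Rightarrow> (real ^ 'n) \<Rightarrow>\<^sub>L real)
      (F'' :: real ^ 'n \<Rightarrow> (real ^ 'n) \<Rightarrow>\<^sub>L ((real ^ 'n) \<Rightarrow>\<^sub>L real)).
      (\<forall>x\<in>S. (F has_derivative blinfun_apply (F' x)) (at x)) \<and>
      (\<forall>x\<in>S. (F' has_derivative blinfun_apply (F'' x)) (at x)) \<and>
      continuous_on S F'')"

definition C12_on :: "real \<Rightarrow> (real \<Rightarrow> real ^ 'n::finite \<Rightarrow> real) \<Rightarrow> bool" where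
  "C12_on T V \<longleftrightarrow>
    (\<exists>(Vt :: real \<Rightarrow> real ^ 'n \<Rightarrow> real) (Vx :: real \<Rightarrow> real ^ 'n \<Rightarrow> real ^ 'n)
      (Vxx :: real \<Rightarrow> real ^ 'n \<Rightarrow> real ^ 'n ^ 'n).
      continuous_on ({0..T} \<times> UNIV) (\<lambda>(s, y). Vt s y) \<and>
      continuous_on ({0..T} \<times> UNIV) (\<lambda>(s, y). Vx s y) \<and>
      continuous_on ({0..T} \<times> UNIV) (\<lambda>(s, y). Vxx s y) \<and>
      (\<forall>s\<in>{0..T}. \<forall>y.
        ((\<lambda>r. V r y) has_real_derivative Vt s y) (at s within {0..T}) \<and>
        (V s has_derivative (\<lambda>h. Vx s y \<bullet> h)) (at y) \<and>
        (Vx s has_derivative (\<lambda>h. Vxx s y *v h)) (at y)))"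

definition hamiltonian ::
  "('n::finite \<Rightarrow> real \<Rightarrow> real ^ 'n \<Rightarrow> real ^ 'n \<Rightarrow> real) \<Rightarrow>
   ('n \<Rightarrow> real \<Rightarrow> real ^ 'n \<Rightarrow> real ^ 'n \<Rightarrow> real) \<Rightarrow>
   ('n \<Rightarrow> real \<Rightarrow> real ^ 'n \<Rightarrow> real \<Rightarrow> real) \<Rightarrow>
   'n \<Rightarrow> real \<Rightarrow> real ^ 'n \<Rightarrow> real ^ 'n \<Rightarrow> real ^ 'n \<Rightarrow> real ^ 'n ^ 'n \<Rightarrow> real" where
  "hamiltonian b \<sigma> f i t x u p A =
    (\<Sum>k\<in>UNIV. b k t x u * p $ k + 1 / 2 * (\<sigma> k t x u)\<^sup>2 * A $ k $ k) + f i t x (u $ i)"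

text \<open>
  \<open>V\<close> is a classical solution of player \<open>i\<close>'s exploratory HJB equation with the opponents'
  actions frozen at \<open>w\<close>. Finiteness of the integral under the logarithm is part of being a
  solution. The time derivative is one-sided at time 0.
\<close>

definition classical_solution ::
  "real \<Rightarrow> real set \<Rightarrow>
   ('n::finite \<Rightarrow> real \<Rightarrow> real ^ 'n \<Rightarrow> real ^ 'n \<Rightarrow> real) \<Rightarrow>
   ('n \<Rightarrow> real \<Rightarrow> real ^ 'n \<Rightarrow> real ^ 'n \<Rightarrow> real) \<Rightarrow>
   ('n \<Rightarrow> real \<Rightarrow> real ^ 'n \<Rightarrow> real \<Rightarrow> real) \<Rightarrow> ('n \<Rightarrow> real ^ 'n \<Rightarrow> real) \<Rightarrow>
   ('n \<Rightarrow> real) \<Rightarrow> ('n \<Rightarrow> real) \<Rightarrow>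
   'n \<Rightarrow> ('n \<Rightarrow> real) \<Rightarrow> (real \<Rightarrow> real ^ 'n \<Rightarrow> real) \<Rightarrow> bool" where
  "classical_solution T U b \<sigma> f g \<beta> \<gamma> i w V \<longleftrightarrow>
    C12_on T V \<and>
    (\<forall>s\<in>{0..<T}. \<forall>y.
      let E = (\<lambda>a. exp (1 / \<gamma> i *
        hamiltonian b \<sigma> f i s y (join i a w) (grad (V s) y) (hessian (V s) y)))
      in set_integrable lborel U E \<and>
         0 = vector_derivative (\<lambda>r. V r y) (at s within {0..T}) - \<beta> i * V s y
             + \<gamma> i * ln (LINT a:U|lborel. E a)) \<and>
    (\<forall>y. V T y = g i y)"

definition local_hamiltonian ::
  "('n::finite \<Rightarrow> real \<Rightarrow> real ^ 'n \<Rightarrow> real ^ 'n \<Rightarrow> real) \<Rightarrow>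
   ('n \<Rightarrow> real \<Rightarrow> real ^ 'n \<Rightarrow> real ^ 'n \<Rightarrow> real) \<Rightarrow>
   ('n \<Rightarrow> real \<Rightarrow> real ^ 'n \<Rightarrow> real \<Rightarrow> real) \<Rightarrow>
   ('n \<Rightarrow> real \<Rightarrow> real ^ 'n \<Rightarrow> ('n \<Rightarrow> real) \<Rightarrow> real) \<Rightarrow>
   'n \<Rightarrow> real \<Rightarrow> real ^ 'n \<Rightarrow> real ^ 'n \<Rightarrow> real" where
  "local_hamiltonian b \<sigma> f v i t x u =
    hamiltonian b \<sigma> f i t x u
      (grad (\<lambda>y. v i t y (opp i u)) x) (hessian (\<lambda>y. v i t y (opp i u)) x)"

text \<open>
  When the denominator is infinite, the Lebesgue integral is 0 by convention and hence so is the
  response; positivity of a response therefore forces its denominator to be finite.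
\<close>

definition response ::
  "real set \<Rightarrow>
   ('n::finite \<Rightarrow> real \<Rightarrow> real ^ 'n \<Rightarrow> real ^ 'n \<Rightarrow> real) \<Rightarrow>
   ('n \<Rightarrow> real \<Rightarrow> real ^ 'n \<Rightarrow> real ^ 'n \<Rightarrow> real) \<Rightarrow>
   ('n \<Rightarrow> real \<Rightarrow> real ^ 'n \<Rightarrow> real \<Rightarrow> real) \<Rightarrow> ('n \<Rightarrow> real) \<Rightarrow>
   ('n \<Rightarrow> real \<Rightarrow> real ^ 'n \<Rightarrow> ('n \<Rightarrow> real) \<Rightarrow> real) \<Rightarrow> real \<Rightarrow> real ^ 'n \<Rightarrow>
   'n \<Rightarrow> real \<Rightarrow> ('n \<Rightarrow> real) \<Rightarrow> real" where
  "response U b \<sigma> f \<gamma> v t x i a w =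
    exp (local_hamiltonian b \<sigma> f v i t x (join i a w) / \<gamma> i) /
    (LINT z:U|lborel. exp (local_hamiltonian b \<sigma> f v i t x (join i z w) / \<gamma> i))"

definition positive_conditional_density ::
  "real set \<Rightarrow> 'n::finite \<Rightarrow> (real \<Rightarrow> ('n \<Rightarrow> real) \<Rightarrow> real) \<Rightarrow> bool" where
  "positive_conditional_density U i q \<longleftrightarrow>
    (\<forall>w\<in>opp_profiles U i.
      (\<forall>a\<in>U. 0 < q a w) \<and> set_integrable lborel U (\<lambda>a. q a w) \<and>
      (LINT a:U|lborel. q a w) = 1)"

definition positive_joint_density ::
  "real set \<Rightarrow> (real ^ 'n::finite \<Rightarrow> real) \<Rightarrow> bool" where
  "positive_joint_density U \<psi> \<longleftrightarrow>
    (\<forall>u\<in>profiles U. 0 < \<psi> u) \<and> set_integrable lborel (profiles U) \<psi> \<and>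
    (LINT u:profiles U|lborel. \<psi> u) = 1"

definition full_conditional ::
  "real set \<Rightarrow> (real ^ 'n::finite \<Rightarrow> real) \<Rightarrow> 'n \<Rightarrow> real \<Rightarrow> ('n \<Rightarrow> real) \<Rightarrow> real" where
  "full_conditional U \<psi> i a w = \<psi> (join i a w) / (LINT z:U|lborel. \<psi> (join i z w))"

text \<open>
  For almost every \<open>u\<^sup>-\<^sup>i\<close> the full conditional and the response agree as densities on \<open>U\<close>,
  that is, up to a Lebesgue null set of own actions.
\<close>

definition conditional_equilibrium ::
  "real set \<Rightarrow> ('n::finite \<Rightarrow> real \<Rightarrow> ('n \<Rightarrow> real) \<Rightarrow> real) \<Rightarrow> (real ^ 'n \<Rightarrow> real) \<Rightarrow> bool" where
  "conditional_equilibrium U \<pi> \<psi> \<longleftrightarrow>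
    positive_joint_density U \<psi> \<and>
    (\<forall>i. AE w in Pi\<^sub>M (- {i}) (\<lambda>_. lborel). w \<in> opp_profiles U i \<longrightarrow>
      (AE a in lborel. a \<in> U \<longrightarrow> full_conditional U \<psi> i a w = \<pi> i a w))"

definition log_response ::
  "('n::finite \<Rightarrow> real \<Rightarrow> ('n \<Rightarrow> real) \<Rightarrow> real) \<Rightarrow> 'n \<Rightarrow> real ^ 'n \<Rightarrow> real" where
  "log_response \<pi> i u = ln (\<pi> i (u $ i) (opp i u))"

definition cross_partials_agree ::
  "real set \<Rightarrow> ('n::finite \<Rightarrow> real \<Rightarrow> ('n \<Rightarrow> real) \<Rightarrow> real) \<Rightarrow> bool" where
  "cross_partials_agree U \<pi> \<longleftrightarrow>
    (\<forall>i j. i \<noteq> j \<longrightarrow> (\<forall>u\<in>interior (profiles U).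
      partial_deriv j (partial_deriv i (log_response \<pi> i)) u =
      partial_deriv i (partial_deriv j (log_response \<pi> j)) u))"

definition response_form ::
  "('n::finite \<Rightarrow> real \<Rightarrow> ('n \<Rightarrow> real) \<Rightarrow> real) \<Rightarrow> real ^ 'n \<Rightarrow> real ^ 'n \<Rightarrow> real" where
  "response_form \<pi> u h = (\<Sum>i\<in>UNIV. partial_deriv i (log_response \<pi> i) u * h $ i)"

definition is_potential ::
  "real set \<Rightarrow> ('n::finite \<Rightarrow> real \<Rightarrow> ('n \<Rightarrow> real) \<Rightarrow> real) \<Rightarrow> (real ^ 'n \<Rightarrow> real) \<Rightarrow> bool" where
  "is_potential U \<pi> \<Phi> \<longleftrightarrow>
    (\<forall>u\<in>interior (profiles U). (\<Phi> has_derivative response_form \<pi> u) (at u))"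

definition normalizable :: "real set \<Rightarrow> (real ^ 'n::finite \<Rightarrow> real) \<Rightarrow> bool" where
  "normalizable U \<psi> \<longleftrightarrow>
    set_integrable lborel (profiles U) \<psi> \<and> 0 < (LINT u:profiles U|lborel. \<psi> u)"

end

(*
  Write L_k for the logarithm of the k-th conditional density, and let I be the interior of U, an
  interval. A function D on the open box I^N is a potential of the one-form with components
  d_k L_k if and only if D - L_k does not depend on the k-th coordinate, for every k; up to
  exponentials this is the factorization psi = pi_k * phi_k. Replacing one coordinate at a time
  by a constant (as in Brook's lemma) rebuilds D from the L_k: if D is right for the coordinates
  in S, then D(u[k := a]) + L_k(u) - L_k(u[k := a]) is right for those in S and for k.
  Applied to functions satisfying the cross-partial identities, this is the Poincare lemma without
  any integration. Applied to ln psi for an equilibrium psi, whose conditionals are known only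
  almost everywhere, it shows that psi is almost everywhere a constant times exp D with D
  differentiable; continuity of D then turns almost everywhere statements into statements on the
  whole box. Two potentials differ by a function independent of each coordinate, that is by a
  constant, which gives uniqueness.
*)

theory Submission
  imports Defs
begin

section \<open>Replacing one coordinate of a profile\<close>

text \<open>An affine formula rather than a case distinction on coordinates, so that the rules for
  derivatives and continuity apply directly; identities between profiles are checked coordinatewise
  through \<open>upd_nth\<close>.\<close>

definition upd :: "'n::finite \<Rightarrow> real \<Rightarrow> real ^ 'n \<Rightarrow> real ^ 'n" where
  "upd k a u = u + (a - u $ k) *\<^sub>R axis k 1"

lemma upd_nth [simp]: "upd k a u $ j = (if j = k then a else u $ j)"
  by (simp add: upd_def axis_def)

lemma join_nth [simp]: "join k a w $ j = (if j = k then a else w j)"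
  by (simp add: join_def)

lemma join_opp: "join k a (opp k u) = upd k a u"
  by (simp add: vec_eq_iff opp_def)

lemma opp_upd [simp]: "opp k (upd k a u) = opp k u"
  by (auto simp: opp_def fun_eq_iff)

lemma upd_upd_same [simp]: "upd k a (upd k b u) = upd k a u"
  by (simp add: vec_eq_iff)

lemma upd_self [simp]: "upd k (u $ k) u = u"
  by (simp add: vec_eq_iff)

lemma upd_commute: "j \<noteq> k \<Longrightarrow> upd j a (upd k b u) = upd k b (upd j a u)"
  by (auto simp: vec_eq_iff)

lemma upd_add_axis_same [simp]: "upd k a (u + s *\<^sub>R axis k 1) = upd k a u"
  by (simp add: vec_eq_iff axis_def)

lemma upd_add_axis_other: "j \<noteq> k \<Longrightarrow> upd k a (u + s *\<^sub>R axis j 1) = upd k a u + s *\<^sub>R axis j 1"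
  by (simp add: vec_eq_iff axis_def)

lemma upd_shift: "upd k c u + s *\<^sub>R axis k 1 = upd k (c + s) u"
  by (simp add: vec_eq_iff axis_def)

lemma has_derivative_upd: "(upd k a has_derivative (\<lambda>h. h - (h $ k) *\<^sub>R axis k 1)) (at u)"
  unfolding upd_def [abs_def]
  by (rule derivative_eq_intros bounded_linear_imp_has_derivative bounded_linear_vec_nth refl | simp)+

lemma continuous_on_upd: "continuous_on S (upd k a)"
  unfolding upd_def [abs_def] by (intro continuous_intros)

lemma continuous_on_upd_value: "continuous_on S (\<lambda>a. upd k a u)"
  unfolding upd_def [abs_def] by (intro continuous_intros)

lemma upd_mem_profiles: "u \<in> profiles I \<Longrightarrow> a \<in> I \<Longrightarrow> upd k a u \<in> profiles I"
  by (simp add: profiles_def)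

lemma profiles_mono: "I \<subseteq> U \<Longrightarrow> profiles I \<subseteq> profiles U"
  by (auto simp: profiles_def)

lemma opp_mem_opp_profiles: "u \<in> profiles U \<Longrightarrow> opp k u \<in> opp_profiles U k"
  by (auto simp: profiles_def opp_def opp_profiles_def)

lemma join_mem_profiles: "a \<in> U \<Longrightarrow> w \<in> opp_profiles U k \<Longrightarrow> join k a w \<in> profiles U"
  by (auto simp: profiles_def opp_profiles_def PiE_iff)

lemma opp_join: "w \<in> extensional (- {k}) \<Longrightarrow> opp k (join k a w) = w"
  by (auto simp: opp_def fun_eq_iff extensional_def)

lemma opp_profiles_extensional: "w \<in> opp_profiles U k \<Longrightarrow> w \<in> extensional (- {k})"
  by (simp add: opp_profiles_def PiE_iff)

section \<open>Topology of boxes\<close>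

lemma open_profiles: "open I \<Longrightarrow> open (profiles I)"
  unfolding profiles_def by (rule open_vector_box) simp

text \<open>For an interior profile \<open>u\<close>, the values \<open>a\<close> that keep
  \<open>upd k a u\<close> in the interior form an open subset of \<open>U\<close> containing
  \<open>u $ k\<close>; the other inclusion holds because a box with open side is open.\<close>

lemma interior_profiles:
  "interior (profiles U) = (profiles (interior U) :: (real ^ 'n::finite) set)"
proof
  show "profiles (interior U) \<subseteq> interior (profiles U :: (real ^ 'n) set)"
    by (intro interior_maximal profiles_mono interior_subset open_profiles open_interior)
  show "interior (profiles U) \<subseteq> (profiles (interior U) :: (real ^ 'n) set)"
  proof
    fix u :: "real ^ 'n" assume u: "u \<in> interior (profiles U)"
    have "u $ k \<in> interior U" for k
    proof -
      have "open ((\<lambda>a. upd k a u) -` interior (profiles U))"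
        by (intro open_vimage continuous_on_upd_value open_interior)
      moreover have "u $ k \<in> (\<lambda>a. upd k a u) -` interior (profiles U)"
        using u by simp
      moreover have "(\<lambda>a. upd k a u) -` interior (profiles U) \<subseteq> U"
      proof
        fix a assume "a \<in> (\<lambda>a. upd k a u) -` interior (profiles U)"
        then have "upd k a u \<in> profiles U"
          using interior_subset by blast
        then have "upd k a u $ k \<in> U"
          unfolding profiles_def by blast
        then show "a \<in> U" by simp
      qed
      ultimately show ?thesis
        by (meson interiorI)
    qed
    then show "u \<in> profiles (interior U)"
      by (simp add: profiles_def)
  qed
qed

text \<open>A coordinate projection maps the box onto its side, as the constant vectors show. This
  is how connectedness of the interior box makes the interior of \<open>U\<close> an
  interval.\<close>

lemma connected_profilesD:
  assumes "connected (profiles I :: (real ^ 'n::finite) set)"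
  shows "connected I"
proof -
  fix k :: 'n
  have "(\<lambda>u. u $ k) ` (profiles I :: (real ^ 'n) set) = I"
  proof
    show "I \<subseteq> (\<lambda>u. u $ k) ` (profiles I :: (real ^ 'n) set)"
    proof
      fix a assume "a \<in> I"
      then show "a \<in> (\<lambda>u. u $ k) ` (profiles I :: (real ^ 'n) set)"
        by (intro image_eqI[of _ _ "\<chi> j. a"]) (auto simp: profiles_def)
    qed
  qed (auto simp: profiles_def)
  moreover have "connected ((\<lambda>u. u $ k) ` (profiles I :: (real ^ 'n) set))"
    by (intro connected_continuous_image continuous_intros assms)
  ultimately show ?thesis by simp
qed

section \<open>Partial derivatives as relations\<close>

text \<open>\<open>partial_deriv\<close> rests on the total function \<open>deriv\<close> and has a
  value even where no derivative exists; this relation also asserts existence.\<close>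

definition has_partial :: "'n::finite \<Rightarrow> (real ^ 'n \<Rightarrow> real) \<Rightarrow> real \<Rightarrow> real ^ 'n \<Rightarrow> bool" where
  "has_partial k F D x \<longleftrightarrow> ((\<lambda>s. F (x + s *\<^sub>R axis k 1)) has_real_derivative D) (at 0)"

lemma has_partial_imp_eq: "has_partial k F D x \<Longrightarrow> partial_deriv k F x = D"
  unfolding has_partial_def partial_deriv_def by (rule DERIV_imp_deriv)

lemma has_partial_add:
  "has_partial k F D x \<Longrightarrow> has_partial k G E x \<Longrightarrow> has_partial k (\<lambda>u. F u + G u) (D + E) x"
  unfolding has_partial_def by (rule DERIV_add)

lemma has_partial_diff:
  "has_partial k F D x \<Longrightarrow> has_partial k G E x \<Longrightarrow> has_partial k (\<lambda>u. F u - G u) (D - E) x"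
  unfolding has_partial_def by (rule DERIV_diff)

lemma has_derivative_imp_has_partial:
  assumes "(F has_derivative F') (at x)"
  shows "has_partial k F (F' (axis k 1)) x"
proof -
  interpret bounded_linear F' using assms by (rule has_derivative_bounded_linear)
  have "((\<lambda>s. x + s *\<^sub>R axis k 1) has_derivative (\<lambda>s. s *\<^sub>R axis k 1)) (at 0)"
    by (auto intro!: derivative_eq_intros)
  moreover have "(F has_derivative F') (at (x + 0 *\<^sub>R axis k 1))"
    using assms by simp
  ultimately have "((\<lambda>s. F (x + s *\<^sub>R axis k 1)) has_derivative (\<lambda>s. F' (s *\<^sub>R axis k 1))) (at 0)"
    by (rule has_derivative_compose)
  then show ?thesis
    by (simp add: has_partial_def has_field_derivative_def scale mult_commute_abs)
qed

text \<open>A linear map is determined by its values on the basis vectors, which here are the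
  partial derivatives.\<close>

lemma has_derivative_partial_sum:
  assumes "(F has_derivative F') (at x)"
  shows "(F has_derivative (\<lambda>h. \<Sum>k\<in>UNIV. partial_deriv k F x * h $ k)) (at x)"
proof -
  interpret bounded_linear F' using assms by (rule has_derivative_bounded_linear)
  have "F' h = (\<Sum>k\<in>UNIV. partial_deriv k F x * h $ k)" for h
  proof -
    have "F' h = F' (\<Sum>k\<in>UNIV. h $ k *\<^sub>R axis k 1)"
      using basis_expansion [of h] by (simp add: scalar_mult_eq_scaleR)
    also have "\<dots> = (\<Sum>k\<in>UNIV. h $ k * F' (axis k 1))"
      by (simp add: sum scale)
    finally show ?thesis
      by (simp add: has_partial_imp_eq [OF has_derivative_imp_has_partial [OF assms]] mult.commute)
  qed
  then show ?thesis using assms by (metis (no_types, lifting) ext)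
qed

lemma differentiable_imp_has_partial:
  "F differentiable at x \<Longrightarrow> has_partial k F (partial_deriv k F x) x"
  by (metis differentiable_def has_derivative_imp_has_partial has_partial_imp_eq)

text \<open>Passes from the increment \<open>s\<close> at zero to the value \<open>c\<close> of the
  coordinate itself, the variable that runs through the interval \<open>I\<close>.\<close>

lemma has_partial_imp_DERIV_upd:
  assumes "has_partial k F D (upd k c u)"
  shows "((\<lambda>c. F (upd k c u)) has_real_derivative D) (at c)"
proof -
  have "((\<lambda>s. F (upd k (s + c) u)) has_real_derivative D) (at 0)"
    using assms unfolding has_partial_def upd_shift by (simp add: add.commute)
  then show ?thesis
    using DERIV_shift [of "\<lambda>c. F (upd k c u)" D 0 c] by simp
qed

section \<open>Functions independent of a coordinate\<close>

text \<open>Expresses that on the box \<open>R\<close> is a function of the opponents' profile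
  \<open>opp k u\<close>, without naming that function.\<close>

definition const_along :: "real set \<Rightarrow> 'n::finite \<Rightarrow> (real ^ 'n \<Rightarrow> 'b) \<Rightarrow> bool" where
  "const_along I k R \<longleftrightarrow> (\<forall>u\<in>profiles I. \<forall>a\<in>I. R (upd k a u) = R u)"

lemma const_alongD: "const_along I k R \<Longrightarrow> u \<in> profiles I \<Longrightarrow> a \<in> I \<Longrightarrow> R (upd k a u) = R u"
  by (simp add: const_along_def)

text \<open>Since \<open>I\<close> is convex, a line parallel to axis \<open>k\<close> meets the box
  in an interval, on which a vanishing derivative forces constancy.\<close>

lemma has_partial_zero_imp_const_along:
  fixes R :: "real ^ 'n::finite \<Rightarrow> real"
  assumes I: "convex I" and zero: "\<And>u. u \<in> profiles I \<Longrightarrow> has_partial k R 0 u"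
  shows "const_along I k R"
  unfolding const_along_def
proof (intro ballI)
  fix u :: "real ^ 'n" and a assume u: "u \<in> profiles I" and a: "a \<in> I"
  have "((\<lambda>c. R (upd k c u)) has_real_derivative 0) (at c within I)" if "c \<in> I" for c
    using has_partial_imp_DERIV_upd [OF zero [OF upd_mem_profiles [OF u that]]]
    by (rule has_field_derivative_at_within)
  then obtain d where d: "\<And>c. c \<in> I \<Longrightarrow> R (upd k c u) = d"
    using has_field_derivative_zero_constant [OF I] by metis
  have "u $ k \<in> I" using u by (simp add: profiles_def)
  then show "R (upd k a u) = R u"
    using d [OF a] d [of "u $ k"] by simp
qed

text \<open>Since \<open>I\<close> is open, \<open>R\<close> agrees with a constant for all small
  displacements along axis \<open>k\<close>.\<close>

lemma const_along_imp_has_partial_zero: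
  assumes "open I" "const_along I k R" "u \<in> profiles I"
  shows "has_partial k R 0 u"
proof -
  have "u $ k \<in> I" using assms by (simp add: profiles_def)
  then have "((\<lambda>c. R (upd k c u)) has_real_derivative 0) (at (u $ k))"
    by (intro has_field_derivative_transform_within_open [OF DERIV_const [of "R u"] assms(1)])
       (use assms const_alongD in metis)+
  then have "((\<lambda>s. R (upd k (s + u $ k) u)) has_real_derivative 0) (at 0)"
    using DERIV_shift [of "\<lambda>c. R (upd k c u)" 0 0 "u $ k"] by simp
  moreover have "upd k (s + u $ k) u = u + s *\<^sub>R axis k 1" for s
    using upd_shift [of k "u $ k" u s] by (simp add: add.commute)
  ultimately show ?thesis by (simp add: has_partial_def)
qed

text \<open>The coordinates of \<open>v\<close> are turned into those of \<open>u\<close> one at a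
  time, by induction on a set outside which the two profiles agree; all intermediate profiles stay
  in the box.\<close>

lemma const_along_all_imp_const:
  assumes "\<And>k. const_along I k R" "u \<in> profiles I" "v \<in> profiles I"
  shows "R u = R v"
proof -
  have "\<forall>v\<in>profiles I. (\<forall>j. j \<notin> S \<longrightarrow> u $ j = v $ j) \<longrightarrow> R u = R v" if "finite S" for S
    using that
  proof induction
    case empty
    then show ?case by (metis empty_iff vec_eq_iff)
  next
    case (insert k S)
    show ?case
    proof (intro ballI impI)
      fix v assume v: "v \<in> profiles I" and eq: "\<forall>j. j \<notin> insert k S \<longrightarrow> u $ j = v $ j"
      have uk: "u $ k \<in> I" using assms(2) by (simp add: profiles_def)
      have "R u = R (upd k (u $ k) v)"
        using insert.IH upd_mem_profiles [OF v uk, of k] eq by simp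
      also have "\<dots> = R v" by (rule const_alongD [OF assms(1) v uk])
      finally show "R u = R v" .
    qed
  qed
  from this [of UNIV] assms(3) show ?thesis by simp
qed

section \<open>Symmetry of second derivatives and twice differentiable functions\<close>

text \<open>The mean value theorem is used twice: in direction \<open>i\<close> for the increment of
  \<open>F\<close> along \<open>j\<close>, then in direction \<open>j\<close> for
  \<open>Gi\<close>.\<close>

lemma double_difference_mean_value:
  fixes F Gi Hij :: "real ^ 'n::finite \<Rightarrow> real"
  assumes "0 < h"
    and mem: "\<And>s t. 0 \<le> s \<Longrightarrow> s \<le> h \<Longrightarrow> 0 \<le> t \<Longrightarrow> t \<le> h \<Longrightarrow>
      x + s *\<^sub>R axis i 1 + t *\<^sub>R axis j 1 \<in> B"
    and Gi: "\<And>y. y \<in> B \<Longrightarrow> has_partial i F (Gi y) y"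
    and Hij: "\<And>y. y \<in> B \<Longrightarrow> has_partial j Gi (Hij y) y"
  obtains s t where "0 < s" "s < h" "0 < t" "t < h"
    "F (x + h *\<^sub>R axis i 1 + h *\<^sub>R axis j 1) - F (x + h *\<^sub>R axis i 1)
       - F (x + h *\<^sub>R axis j 1) + F x
     = h * h * Hij (x + s *\<^sub>R axis i 1 + t *\<^sub>R axis j 1)"
proof -
  have F_deriv: "((\<lambda>s. F (x + s *\<^sub>R axis i 1 + t *\<^sub>R axis j 1)) has_real_derivative
      Gi (x + s *\<^sub>R axis i 1 + t *\<^sub>R axis j 1)) (at s)"
    if "0 \<le> s" "s \<le> h" "0 \<le> t" "t \<le> h" for s t
  proof -
    have "((\<lambda>r. F (x + (r + s) *\<^sub>R axis i 1 + t *\<^sub>R axis j 1)) has_real_derivative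
      Gi (x + s *\<^sub>R axis i 1 + t *\<^sub>R axis j 1)) (at 0)"
      using Gi [OF mem [OF that]] unfolding has_partial_def
      by (simp add: algebra_simps)
    then show ?thesis
      using DERIV_shift [of "\<lambda>s. F (x + s *\<^sub>R axis i 1 + t *\<^sub>R axis j 1)" _ 0 s] by simp
  qed
  have G_deriv: "((\<lambda>t. Gi (x + s *\<^sub>R axis i 1 + t *\<^sub>R axis j 1)) has_real_derivative
      Hij (x + s *\<^sub>R axis i 1 + t *\<^sub>R axis j 1)) (at t)"
    if "0 \<le> s" "s \<le> h" "0 \<le> t" "t \<le> h" for s t
  proof -
    have "((\<lambda>r. Gi (x + s *\<^sub>R axis i 1 + (r + t) *\<^sub>R axis j 1)) has_real_derivative
      Hij (x + s *\<^sub>R axis i 1 + t *\<^sub>R axis j 1)) (at 0)"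
      using Hij [OF mem [OF that]] unfolding has_partial_def
      by (simp add: algebra_simps)
    then show ?thesis
      using DERIV_shift [of "\<lambda>t. Gi (x + s *\<^sub>R axis i 1 + t *\<^sub>R axis j 1)" _ 0 t] by simp
  qed
  \<comment> \<open>The summand \<open>0 *\<^sub>R axis j 1\<close> is left unsimplified so that
    both terms are instances of \<open>F_deriv\<close>, with \<open>t\<close> equal to
    \<open>h\<close> and to 0.\<close>
  define \<phi> where "\<phi> s = F (x + s *\<^sub>R axis i 1 + h *\<^sub>R axis j 1)
    - F (x + s *\<^sub>R axis i 1 + 0 *\<^sub>R axis j 1)" for s
  have "(\<phi> has_real_derivative Gi (x + s *\<^sub>R axis i 1 + h *\<^sub>R axis j 1)
      - Gi (x + s *\<^sub>R axis i 1 + 0 *\<^sub>R axis j 1)) (at s)" if "0 \<le> s" "s \<le> h" for s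
    unfolding \<phi>_def using that \<open>0 < h\<close> by (intro DERIV_diff F_deriv) auto
  from MVT2 [OF \<open>0 < h\<close> this] obtain s where s: "0 < s" "s < h" and \<phi>:
    "\<phi> h - \<phi> 0 = h * (Gi (x + s *\<^sub>R axis i 1 + h *\<^sub>R axis j 1)
      - Gi (x + s *\<^sub>R axis i 1 + 0 *\<^sub>R axis j 1))"
    by auto
  have "((\<lambda>t. Gi (x + s *\<^sub>R axis i 1 + t *\<^sub>R axis j 1)) has_real_derivative
      Hij (x + s *\<^sub>R axis i 1 + t *\<^sub>R axis j 1)) (at t)" if "0 \<le> t" "t \<le> h" for t
    using that s by (intro G_deriv) auto
  from MVT2 [OF \<open>0 < h\<close> this] obtain t where t: "0 < t" "t < h" and
    "Gi (x + s *\<^sub>R axis i 1 + h *\<^sub>R axis j 1) - Gi (x + s *\<^sub>R axis i 1 + 0 *\<^sub>R axis j 1)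
      = h * Hij (x + s *\<^sub>R axis i 1 + t *\<^sub>R axis j 1)"
    by auto
  with \<phi> have "\<phi> h - \<phi> 0 = h * h * Hij (x + s *\<^sub>R axis i 1 + t *\<^sub>R axis j 1)"
    by simp
  then show ?thesis
    using s t by (intro that [of s t]) (simp_all add: \<phi>_def)
qed

text \<open>The Clairaut-Schwarz theorem: the second difference over a small square at
  \<open>x\<close> is \<open>h * h\<close> times a value of \<open>Hij\<close> near
  \<open>x\<close>, and also \<open>h * h\<close> times a value of \<open>Hji\<close> near
  \<open>x\<close>. The partials are arbitrary given functions so that the result also covers a
  potential, whose first partials come from different functions.\<close>

lemma mixed_partials_eq:
  fixes F Gi Gj Hij Hji :: "real ^ 'n::finite \<Rightarrow> real"
  assumes B: "open B" "x \<in> B"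
    and Gi: "\<And>y. y \<in> B \<Longrightarrow> has_partial i F (Gi y) y"
    and Gj: "\<And>y. y \<in> B \<Longrightarrow> has_partial j F (Gj y) y"
    and Hij: "\<And>y. y \<in> B \<Longrightarrow> has_partial j Gi (Hij y) y"
    and Hji: "\<And>y. y \<in> B \<Longrightarrow> has_partial i Gj (Hji y) y"
    and cont: "continuous_on B Hij" "continuous_on B Hji"
  shows "Hij x = Hji x"
proof (rule ccontr)
  assume ne: "Hij x \<noteq> Hji x"
  \<comment> \<open>Half the gap: two equal numbers cannot lie within \<open>e\<close> of
    \<open>Hij x\<close> and \<open>Hji x\<close> respectively.\<close>
  define e where "e = \<bar>Hij x - Hji x\<bar> / 2"
  have "e > 0" using ne by (simp add: e_def)
  have "isCont Hij x" "isCont Hji x"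
    using cont B by (simp_all add: continuous_on_eq_continuous_at)
  then obtain d1 d2 where d: "d1 > 0" "d2 > 0"
    and d1: "\<And>y. dist y x < d1 \<Longrightarrow> dist (Hij y) (Hij x) < e"
    and d2: "\<And>y. dist y x < d2 \<Longrightarrow> dist (Hji y) (Hji x) < e"
    unfolding continuous_at_eps_delta using \<open>e > 0\<close> by (metis (no_types, opaque_lifting))
  obtain r where r: "r > 0" "ball x r \<subseteq> B"
    using B open_contains_ball by blast
  \<comment> \<open>Two displacements of length at most \<open>h\<close> move a point by at most
    \<open>2 * h\<close>, strictly less than each of the three radii.\<close>
  define h where "h = Min {d1, d2, r} / 3"
  have h: "0 < h" "3 * h \<le> d1" "3 * h \<le> d2" "3 * h \<le> r"
    using d r by (auto simp: h_def)
  have dist: "dist (x + s *\<^sub>R axis k 1 + t *\<^sub>R axis l 1) x < 3 * h"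
    if "0 \<le> s" "s \<le> h" "0 \<le> t" "t \<le> h" for s t and k l :: 'n
  proof -
    have "dist (x + s *\<^sub>R axis k 1 + t *\<^sub>R axis l 1) x
        = norm (s *\<^sub>R axis k 1 + t *\<^sub>R axis l 1 :: real ^ 'n)"
      by (simp add: dist_norm)
    also have "\<dots> \<le> norm (s *\<^sub>R axis k 1 :: real ^ 'n) + norm (t *\<^sub>R axis l 1 :: real ^ 'n)"
      by (rule norm_triangle_ineq)
    also have "\<dots> \<le> h + h" using that by (intro add_mono) simp_all
    also have "\<dots> < 3 * h" using h by simp
    finally show ?thesis .
  qed
  have mem: "x + s *\<^sub>R axis k 1 + t *\<^sub>R axis l 1 \<in> B"
    if "0 \<le> s" "s \<le> h" "0 \<le> t" "t \<le> h" for s t and k l :: 'n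
    using dist [OF that, of k l] h(4) r(2) by (auto simp: subset_iff dist_commute)
  obtain s t where st: "0 < s" "s < h" "0 < t" "t < h"
    "F (x + h *\<^sub>R axis i 1 + h *\<^sub>R axis j 1) - F (x + h *\<^sub>R axis i 1)
       - F (x + h *\<^sub>R axis j 1) + F x
     = h * h * Hij (x + s *\<^sub>R axis i 1 + t *\<^sub>R axis j 1)"
    by (rule double_difference_mean_value [OF h(1) mem Gi Hij])
  obtain s' t' where st': "0 < s'" "s' < h" "0 < t'" "t' < h"
    "F (x + h *\<^sub>R axis j 1 + h *\<^sub>R axis i 1) - F (x + h *\<^sub>R axis j 1)
       - F (x + h *\<^sub>R axis i 1) + F x
     = h * h * Hji (x + s' *\<^sub>R axis j 1 + t' *\<^sub>R axis i 1)"
    by (rule double_difference_mean_value [OF h(1) mem Gj Hji])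
  have "x + h *\<^sub>R axis i 1 + h *\<^sub>R axis j 1 = x + h *\<^sub>R axis j 1 + h *\<^sub>R axis i 1"
    by (simp add: algebra_simps)
  from st'(5) [folded this] st(5)
  have "h * h * Hij (x + s *\<^sub>R axis i 1 + t *\<^sub>R axis j 1)
      = h * h * Hji (x + s' *\<^sub>R axis j 1 + t' *\<^sub>R axis i 1)"
    by linarith
  then have "Hij (x + s *\<^sub>R axis i 1 + t *\<^sub>R axis j 1)
      = Hji (x + s' *\<^sub>R axis j 1 + t' *\<^sub>R axis i 1)"
    using h by simp
  moreover have "dist (Hij (x + s *\<^sub>R axis i 1 + t *\<^sub>R axis j 1)) (Hij x) < e"
    using dist [of s t i j] st h by (intro d1) simp
  moreover have "dist (Hji (x + s' *\<^sub>R axis j 1 + t' *\<^sub>R axis i 1)) (Hji x) < e"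
    using dist [of s' t' j i] st' h by (intro d2) simp
  ultimately show False
    by (simp add: e_def dist_real_def field_simps abs_if split: if_splits)
qed

text \<open>Evaluation at an axis vector is bounded linear, so differentiability and continuity pass
  from the operator-valued derivatives to the partials.\<close>

lemma C2_on_partials:
  assumes B: "open B" and C2: "C2_on B F"
  shows C2_on_differentiable: "\<And>u. u \<in> B \<Longrightarrow> F differentiable (at u)"
    and C2_on_partial_differentiable:
      "\<And>u j. u \<in> B \<Longrightarrow> partial_deriv j F differentiable (at u)"
    and C2_on_continuous_second_partial:
      "\<And>j k. continuous_on B (partial_deriv k (partial_deriv j F))"
proof -
  obtain F' F'' where
    F': "\<And>x. x \<in> B \<Longrightarrow> (F has_derivative blinfun_apply (F' x)) (at x)" and
    F'': "\<And>x. x \<in> B \<Longrightarrow> (F' has_derivative blinfun_apply (F'' x)) (at x)" and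
    cont: "continuous_on B F''"
    using C2 unfolding C2_on_def by blast
  show "F differentiable (at u)" if "u \<in> B" for u
    using F' [OF that] by (auto simp: differentiable_def)
  have pd: "partial_deriv j F u = F' u (axis j 1)" if "u \<in> B" for u j
    by (rule has_partial_imp_eq [OF has_derivative_imp_has_partial [OF F' [OF that]]])
  have pd': "(partial_deriv j F has_derivative (\<lambda>h. F'' u h (axis j 1))) (at u)" if "u \<in> B" for u j
  proof (rule has_derivative_transform_within_open [OF _ B that])
    show "((\<lambda>u. F' u (axis j 1)) has_derivative (\<lambda>h. F'' u h (axis j 1))) (at u)"
      using bounded_linear.has_derivative [OF blinfun.bounded_linear_left F'' [OF that]] .
  qed (simp add: pd)
  show "partial_deriv j F differentiable (at u)" if "u \<in> B" for u j
    using pd' [OF that] by (auto simp: differentiable_def)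
  have "partial_deriv k (partial_deriv j F) u = F'' u (axis k 1) (axis j 1)" if "u \<in> B" for u j k
    by (rule has_partial_imp_eq [OF has_derivative_imp_has_partial [OF pd' [OF that]]])
  moreover have "continuous_on B (\<lambda>u. F'' u (axis k 1) (axis j 1))" for j k
    by (intro continuous_intros cont)
  ultimately show "continuous_on B (partial_deriv k (partial_deriv j F))" for j k
    by (metis (mono_tags, lifting) continuous_on_cong)
qed

lemma C2_on_mixed_partials_eq:
  assumes "open B" "C2_on B F" "u \<in> B"
  shows "partial_deriv k (partial_deriv j F) u = partial_deriv j (partial_deriv k F) u"
proof (rule mixed_partials_eq [OF assms(1,3)])
  fix y assume "y \<in> B"
  then show "has_partial j F (partial_deriv j F y) y" "has_partial k F (partial_deriv k F y) y"
    "has_partial k (partial_deriv j F) (partial_deriv k (partial_deriv j F) y) y"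
    "has_partial j (partial_deriv k F) (partial_deriv j (partial_deriv k F) y) y"
    by (intro differentiable_imp_has_partial C2_on_differentiable [OF assms(1,2)]
        C2_on_partial_differentiable [OF assms(1,2)]; assumption)+
qed (intro C2_on_continuous_second_partial assms(1,2))+

lemma C2_on_ln:
  assumes C2: "C2_on B F" and pos: "\<And>u. u \<in> B \<Longrightarrow> F u > 0"
  shows "C2_on B (\<lambda>u. ln (F u))"
proof -
  obtain F' F'' where
    F': "\<And>x. x \<in> B \<Longrightarrow> (F has_derivative blinfun_apply (F' x)) (at x)" and
    F'': "\<And>x. x \<in> B \<Longrightarrow> (F' has_derivative blinfun_apply (F'' x)) (at x)" and
    cont: "continuous_on B F''"
    using C2 unfolding C2_on_def by blast
  have contF: "continuous_on B F" "continuous_on B F'"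
    using F' F'' by (meson continuous_at_imp_continuous_on has_derivative_continuous)+
  \<comment> \<open>The derivatives of \<open>ln F\<close> of order one and two: DF / F, and D2F / F
    minus the tensor square of DF divided by the square of F.\<close>
  define G where "G u = inverse (F u) *\<^sub>R F' u" for u
  define H where "H u = inverse (F u) *\<^sub>R F'' u
      - (inverse (F u))\<^sup>2 *\<^sub>R (blinfun_scaleR_left (F' u) o\<^sub>L F' u)" for u
  have "((\<lambda>u. ln (F u)) has_derivative blinfun_apply (G x)) (at x)" if "x \<in> B" for x
    using F' [OF that] pos [OF that] unfolding G_def
    by (auto intro!: derivative_eq_intros simp: fun_eq_iff blinfun.scaleR_left field_simps)
  moreover have "(G has_derivative blinfun_apply (H x)) (at x)" if "x \<in> B" for x
    unfolding G_def [abs_def]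
    using F' [OF that] F'' [OF that] pos [OF that]
    by (auto intro!: derivative_eq_intros
        simp: H_def fun_eq_iff blinfun.scaleR_left blinfun.diff_left power2_eq_square
          algebra_simps)
  moreover have "continuous_on B H"
    unfolding H_def [abs_def] 
    by (intro continuous_intros cont contF bounded_linear.continuous_on [OF bounded_linear_blinfun_scaleR_left])
       (use pos in force)+
  ultimately show ?thesis unfolding C2_on_def by blast
qed

section \<open>One-forms with separate components and their potentials\<close>

text \<open>The one-form of the responses with an arbitrary family \<open>L\<close> in place of the
  log responses; component \<open>k\<close> is taken from its own function
  \<open>L k\<close>.\<close>

definition coordinate_form :: "('n::finite \<Rightarrow> real ^ 'n \<Rightarrow> real) \<Rightarrow> real ^ 'n \<Rightarrow> real ^ 'n \<Rightarrow> real" where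
  "coordinate_form L u h = (\<Sum>k\<in>UNIV. partial_deriv k (L k) u * h $ k)"

lemma coordinate_form_has_partial:
  assumes "(\<Phi> has_derivative coordinate_form L u) (at u)"
  shows "has_partial k \<Phi> (partial_deriv k (L k) u) u"
  using has_derivative_imp_has_partial [OF assms, of k]
  by (simp add: coordinate_form_def axis_def if_distrib cong: if_cong)

text \<open>Partial derivatives alone do not give a total derivative; once differentiability is
  known, they identify it.\<close>

lemma coordinate_formI:
  assumes "D differentiable (at u)" "\<And>k. has_partial k D (partial_deriv k (L k) u) u"
  shows "(D has_derivative coordinate_form L u) (at u)"
proof -
  obtain D' where "(D has_derivative D') (at u)"
    using assms(1) by (auto simp: differentiable_def)
  from has_derivative_partial_sum [OF this] show ?thesis
    by (simp add: has_partial_imp_eq [OF assms(2)] coordinate_form_def [abs_def])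
qed

lemma differentiable_compose_upd:
  "F differentiable (at (upd k a u)) \<Longrightarrow> (\<lambda>u. F (upd k a u)) differentiable (at u)"
  unfolding differentiable_def by (blast intro: has_derivative_compose [OF has_derivative_upd])

lemma has_partial_compose_upd_other:
  "j \<noteq> k \<Longrightarrow> has_partial j F D (upd k a u) \<Longrightarrow> has_partial j (\<lambda>u. F (upd k a u)) D u"
  by (simp add: has_partial_def upd_add_axis_other)

lemma has_partial_compose_upd_same: "has_partial k (\<lambda>u. F (upd k a u)) 0 u"
  by (simp add: has_partial_def)

context
  fixes I :: "real set" and L :: "'n::finite \<Rightarrow> real ^ 'n \<Rightarrow> real"
  assumes I: "open I" "convex I"
    and C2: "\<And>k. C2_on (profiles I) (L k)"
begin

lemma family_differentiable: "u \<in> profiles I \<Longrightarrow> L k differentiable (at u)"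
  by (rule C2_on_differentiable [OF open_profiles [OF I(1)] C2])

lemma family_has_partial: "u \<in> profiles I \<Longrightarrow> has_partial j (L k) (partial_deriv j (L k) u) u"
  by (rule differentiable_imp_has_partial [OF family_differentiable])

lemma family_has_second_partial:
  "u \<in> profiles I \<Longrightarrow>
    has_partial l (partial_deriv j (L k)) (partial_deriv l (partial_deriv j (L k)) u) u"
  by (intro differentiable_imp_has_partial C2_on_partial_differentiable [OF open_profiles [OF I(1)] C2])

text \<open>Induction on the set \<open>S\<close> of coordinates whose component is already right.
  Differentiability is carried along, because \<open>coordinate_formI\<close> needs it at the
  end.\<close>

lemma potential_exists:
  assumes I_ne: "I \<noteq> {}"
    and cross: "\<And>j k u. j \<noteq> k \<Longrightarrow> u \<in> profiles I \<Longrightarrow>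
    partial_deriv j (partial_deriv k (L k)) u = partial_deriv k (partial_deriv j (L j)) u"
  shows "\<exists>\<Phi>. \<forall>u\<in>profiles I. (\<Phi> has_derivative coordinate_form L u) (at u)"
proof -
  obtain a where a: "a \<in> I" using I_ne by blast
  \<comment> \<open>The \<open>k\<close>-th partials of \<open>partial_deriv j (L k)\<close> and \<open>partial_deriv j (L j)\<close> agree.\<close>
  have shifted: "partial_deriv j (L k) u - partial_deriv j (L k) (upd k a u)
      = partial_deriv j (L j) u - partial_deriv j (L j) (upd k a u)"
    if "j \<noteq> k" "u \<in> profiles I" for j k u
  proof -
    have "const_along I k (\<lambda>u. partial_deriv j (L k) u - partial_deriv j (L j) u)"
    proof (rule has_partial_zero_imp_const_along [OF I(2)])
      fix u :: "real ^ 'n" assume u: "u \<in> profiles I"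
      have "partial_deriv k (partial_deriv j (L k)) u = partial_deriv k (partial_deriv j (L j)) u"
        using C2_on_mixed_partials_eq [OF open_profiles [OF I(1)] C2 u, of k j k] cross [OF that(1) u]
        by simp
      then show "has_partial k (\<lambda>u. partial_deriv j (L k) u - partial_deriv j (L j) u) 0 u"
        using has_partial_diff [OF family_has_second_partial [OF u, of k j k]
            family_has_second_partial [OF u, of k j j]] by simp
    qed
    from const_alongD [OF this that(2) a] show ?thesis by linarith
  qed
  have "\<exists>\<Phi>. \<forall>u\<in>profiles I. \<Phi> differentiable (at u) \<and>
      (\<forall>k\<in>S. has_partial k \<Phi> (partial_deriv k (L k) u) u)" if "finite S" for S
    using that
  proof induction
    case empty
    then show ?case by (intro exI [of _ "\<lambda>_. 0"]) auto
  next
    case (insert k S)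
    then obtain \<Phi> where
      diff: "\<And>u. u \<in> profiles I \<Longrightarrow> \<Phi> differentiable (at u)" and
      part: "\<And>u j. u \<in> profiles I \<Longrightarrow> j \<in> S \<Longrightarrow> has_partial j \<Phi> (partial_deriv j (L j) u) u"
      by blast
    \<comment> \<open>\<open>\<Phi> (upd k a u)\<close> and \<open>L k (upd k a u)\<close> ignore
      coordinate \<open>k\<close>, so partial \<open>k\<close> is that of \<open>L k\<close>. For
      \<open>j\<close> in \<open>S\<close>, \<open>shifted\<close> says that the bracket moves
      partial \<open>j\<close> of \<open>\<Phi>\<close> from its value at \<open>upd k a u\<close>
      to the required one at \<open>u\<close>.\<close>
    define \<Psi> where "\<Psi> u = \<Phi> (upd k a u) + (L k u - L k (upd k a u))" for u
    have "\<Psi> differentiable (at u)" if u: "u \<in> profiles I" for u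
      unfolding \<Psi>_def [abs_def]
      by (intro differentiable_add differentiable_diff differentiable_compose_upd diff
          family_differentiable upd_mem_profiles u a)
    moreover have "has_partial j \<Psi> (partial_deriv j (L j) u) u"
      if u: "u \<in> profiles I" and j: "j \<in> insert k S" for u j
    proof (cases "j = k")
      case True
      have "has_partial k \<Psi> (0 + (partial_deriv k (L k) u - 0)) u"
        unfolding \<Psi>_def [abs_def]
        by (intro has_partial_add has_partial_diff has_partial_compose_upd_same family_has_partial u)
      then show ?thesis using True by simp
    next
      case False
      then have "j \<in> S" using j by simp
      have u': "upd k a u \<in> profiles I" by (rule upd_mem_profiles [OF u a])
      have "has_partial j \<Psi> (partial_deriv j (L j) (upd k a u)
          + (partial_deriv j (L k) u - partial_deriv j (L k) (upd k a u))) u"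
        unfolding \<Psi>_def [abs_def]
        by (intro has_partial_add has_partial_diff has_partial_compose_upd_other
            part family_has_partial u u' False \<open>j \<in> S\<close>)
      then show ?thesis using shifted [OF False u] by simp
    qed
    ultimately show ?case by (intro exI [of _ \<Psi>]) blast
  qed
  from this [of UNIV] obtain \<Phi> where "\<And>u. u \<in> profiles I \<Longrightarrow> \<Phi> differentiable (at u)"
    "\<And>u k. u \<in> profiles I \<Longrightarrow> has_partial k \<Phi> (partial_deriv k (L k) u) u"
    by auto
  then show ?thesis using coordinate_formI by blast
qed

text \<open>Both sides say that partial \<open>k\<close> of \<open>D - L k\<close> vanishes on the
  box for every \<open>k\<close>. One direction uses that \<open>I\<close> is an interval, the other
  that it is open.\<close>

lemma potential_iff_const_along:
  assumes diff: "\<And>u. u \<in> profiles I \<Longrightarrow> D differentiable (at u)"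
  shows "(\<forall>u\<in>profiles I. (D has_derivative coordinate_form L u) (at u)) \<longleftrightarrow>
    (\<forall>k. const_along I k (\<lambda>u. D u - L k u))"
proof (intro iffI allI ballI)
  fix k
  assume *: "\<forall>u\<in>profiles I. (D has_derivative coordinate_form L u) (at u)"
  show "const_along I k (\<lambda>u. D u - L k u)"
  proof (rule has_partial_zero_imp_const_along [OF I(2)])
    fix u :: "real ^ 'n" assume u: "u \<in> profiles I"
    show "has_partial k (\<lambda>u. D u - L k u) 0 u"
      using has_partial_diff [OF coordinate_form_has_partial [OF bspec [OF * u]] family_has_partial [OF u],
          of k k]
      by simp
  qed
next
  fix u :: "real ^ 'n"
  assume *: "\<forall>k. const_along I k (\<lambda>u. D u - L k u)" and u: "u \<in> profiles I"
  show "(D has_derivative coordinate_form L u) (at u)"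
  proof (rule coordinate_formI [OF diff [OF u]])
    fix k
    have "has_partial k (\<lambda>u. D u - L k u + L k u) (0 + partial_deriv k (L k) u) u"
      by (intro has_partial_add family_has_partial u
          const_along_imp_has_partial_zero [OF I(1) spec [OF *]])
    then show "has_partial k D (partial_deriv k (L k) u) u" by simp
  qed
qed

text \<open>The two sides are the mixed second partials of \<open>\<Phi>\<close>; they exist and are
  continuous because the components of the form are partials of C2 functions.\<close>

lemma potential_imp_cross_partials:
  assumes pot: "\<And>u. u \<in> profiles I \<Longrightarrow> (\<Phi> has_derivative coordinate_form L u) (at u)"
    and u: "u \<in> profiles I"
  shows "partial_deriv j (partial_deriv k (L k)) u = partial_deriv k (partial_deriv j (L j)) u"
proof (rule mixed_partials_eq [OF open_profiles [OF I(1)] u])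
  fix y :: "real ^ 'n" assume y: "y \<in> profiles I"
  show "has_partial k \<Phi> (partial_deriv k (L k) y) y" "has_partial j \<Phi> (partial_deriv j (L j) y) y"
    using coordinate_form_has_partial [OF pot [OF y]] by blast+
qed (intro family_has_second_partial C2_on_continuous_second_partial [OF open_profiles [OF I(1)] C2];
     assumption)+

end

section \<open>Lebesgue measure split into own action and opponents' profile\<close>

abbreviation opp_lborel :: "'n::finite \<Rightarrow> ('n \<Rightarrow> real) measure" where
  "opp_lborel k \<equiv> Pi\<^sub>M (- {k}) (\<lambda>_. lborel)"

interpretation lborel_product: product_sigma_finite "\<lambda>_. lborel :: real measure"
  by standard

lemma sigma_finite_opp_lborel: "sigma_finite_measure (opp_lborel (k :: 'n::finite))"
  by (rule lborel_product.sigma_finite) simp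

lemma pair_sigma_finite_opp_lborel:
  "pair_sigma_finite (opp_lborel (k :: 'n::finite)) (lborel :: real measure)"
  by (intro pair_sigma_finite.intro sigma_finite_opp_lborel lborel.sigma_finite_measure_axioms)

text \<open>Expansion in the axis vectors reduces measurability to the real coordinates.\<close>

lemma measurable_join [measurable]:
  "(\<lambda>(w, a). join k a w) \<in> borel_measurable (opp_lborel (k :: 'n::finite) \<Otimes>\<^sub>M lborel)"
proof -
  have "(\<lambda>z. if j = k then snd z else fst z j) \<in> borel_measurable (opp_lborel k \<Otimes>\<^sub>M lborel)" for j
  proof (cases "j = k")
    case False
    have "(\<lambda>z. fst z j) \<in> measurable (opp_lborel k \<Otimes>\<^sub>M lborel) lborel"
      by (rule measurable_compose [OF measurable_fst measurable_component_singleton])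
         (use False in auto)
    then show ?thesis using False by simp
  qed simp
  then have "(\<lambda>z. \<Sum>j\<in>UNIV. (if j = k then snd z else fst z j) *\<^sub>R (axis j 1 :: real ^ 'n))
      \<in> borel_measurable (opp_lborel k \<Otimes>\<^sub>M lborel)"
    by (intro borel_measurable_sum borel_measurable_scaleR borel_measurable_const)
  moreover have "(\<Sum>j\<in>UNIV. (if j = k then snd z else fst z j) *\<^sub>R axis j 1) = join k (snd z) (fst z)"
    for z :: "('n \<Rightarrow> real) \<times> real"
    using basis_expansion [of "join k (snd z) (fst z)"] by (simp add: scalar_mult_eq_scaleR)
  ultimately show ?thesis by (simp add: case_prod_unfold)
qed

text \<open>Lebesgue measure is determined by its values on boxes, and the preimage of a box is an
  opponents' box times an interval. This makes Fubini arguments available for slices of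
  profiles.\<close>

lemma lborel_eq_distr_join:
  "(lborel :: (real ^ 'n::finite) measure)
    = distr (opp_lborel k \<Otimes>\<^sub>M lborel) borel (\<lambda>(w, a). join k a w)"
proof (rule lborel_eqI)
  fix l u :: "real ^ 'n"
  assume le: "\<And>b. b \<in> Basis \<Longrightarrow> l \<bullet> b \<le> u \<bullet> b"
  have lu: "l $ j \<le> u $ j" for j
    using le [of "axis j 1"] by (simp add: inner_axis axis_in_Basis_iff)
  interpret P: pair_sigma_finite "opp_lborel k" "lborel :: real measure"
    by (rule pair_sigma_finite_opp_lborel)
  have pre: "(\<lambda>(w, a). join k a w) -` box l u \<inter> space (opp_lborel k \<Otimes>\<^sub>M lborel)
      = (\<Pi>\<^sub>E j\<in>- {k}. {l $ j<..<u $ j}) \<times> {l $ k<..<u $ k}"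
  proof (rule set_eqI, clarify)
    fix w :: "'n \<Rightarrow> real" and a :: real
    have "join k a w \<in> box l u \<longleftrightarrow> (\<forall>j\<in>- {k}. l $ j < w j \<and> w j < u $ j) \<and> l $ k < a \<and> a < u $ k"
      by (simp add: mem_box_cart) (metis ComplI singletonD ComplD singletonI)
    then show "(w, a) \<in> (\<lambda>(w, a). join k a w) -` box l u \<inter> space (opp_lborel k \<Otimes>\<^sub>M lborel) \<longleftrightarrow>
      (w, a) \<in> (\<Pi>\<^sub>E j\<in>- {k}. {l $ j<..<u $ j}) \<times> {l $ k<..<u $ k}"
      by (simp only: space_pair_measure space_PiM mem_Times_iff vimage_eq Int_iff PiE_iff
          greaterThanLessThan_iff fst_conv snd_conv prod.case space_lborel space_borel UNIV_I) blast
  qed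
  have "emeasure (distr (opp_lborel k \<Otimes>\<^sub>M lborel) borel (\<lambda>(w, a). join k a w)) (box l u)
      = emeasure (opp_lborel k \<Otimes>\<^sub>M lborel) ((\<Pi>\<^sub>E j\<in>- {k}. {l $ j<..<u $ j}) \<times> {l $ k<..<u $ k})"
    by (subst emeasure_distr [OF measurable_join]) (simp_all add: pre)
  also have "\<dots> = emeasure (opp_lborel k) (\<Pi>\<^sub>E j\<in>- {k}. {l $ j<..<u $ j})
      * emeasure lborel {l $ k<..<u $ k}"
    by (intro lborel.emeasure_pair_measure_Times sets_PiM_I_finite) auto
  also have "\<dots> = (\<Prod>j\<in>- {k}. ennreal (u $ j - l $ j)) * ennreal (u $ k - l $ k)"
    by (subst lborel_product.emeasure_PiM) (simp_all add: lu)
  also have "\<dots> = (\<Prod>j\<in>UNIV. ennreal (u $ j - l $ j))"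
    by (subst prod.remove [of UNIV k]) (simp_all add: mult.commute Compl_eq_Diff_UNIV)
  also have "\<dots> = ennreal (\<Prod>j\<in>UNIV. u $ j - l $ j)"
    by (rule prod_ennreal) (simp add: lu)
  also have "(\<Prod>j\<in>UNIV. u $ j - l $ j) = (\<Prod>b\<in>Basis. (u - l) \<bullet> b)"
  proof -
    have Basis: "(Basis :: (real ^ 'n) set) = range (\<lambda>j. axis j 1)"
      by (auto simp: Basis_vec_def)
    have "inj (\<lambda>j. axis j (1::real) :: real ^ 'n)"
      by (simp add: inj_on_def axis_eq_axis)
    then show ?thesis unfolding Basis by (simp add: prod.reindex inner_axis)
  qed
  finally show "emeasure (distr (opp_lborel k \<Otimes>\<^sub>M lborel) borel (\<lambda>(w, a). join k a w)) (box l u)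
      = ennreal (\<Prod>b\<in>Basis. (u - l) \<bullet> b)" .
qed simp

text \<open>Trades a possibly non-measurable \<open>P\<close> for avoidance of a Borel null
  set.\<close>

lemma AE_obtain_borel_cover:
  assumes "AE u in lborel. P u"
  obtains N where "N \<in> null_sets lborel" "\<And>u. u \<notin> N \<Longrightarrow> P u"
  using assms by (auto simp: eventually_ae_filter)

text \<open>Fubini for null sets, in both orders. Exchanging the quantifiers calls for a measurable
  set, hence the passage to the Borel cover \<open>N\<close>.\<close>

lemma AE_lborel_imp_AE_join:
  fixes k :: "'n::finite"
  assumes "AE u in lborel. P u"
  shows AE_opp_AE_own: "AE w in opp_lborel k. AE a in lborel. P (join k a w)"
    and AE_own_AE_opp: "AE a in lborel. AE w in opp_lborel k. P (join k a w)"
proof -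
  interpret P: pair_sigma_finite "opp_lborel k" "lborel :: real measure"
    by (rule pair_sigma_finite_opp_lborel)
  obtain N where N: "N \<in> null_sets lborel" and NP: "\<And>u. u \<notin> N \<Longrightarrow> P u"
    using assms AE_obtain_borel_cover by blast
  have [measurable]: "N \<in> sets borel" using N by auto
  have "AE u in distr (opp_lborel k \<Otimes>\<^sub>M lborel) borel (\<lambda>(w, a). join k a w). u \<notin> N"
    unfolding lborel_eq_distr_join [symmetric] by (rule AE_not_in [OF N])
  then have "AE z in opp_lborel k \<Otimes>\<^sub>M lborel. (case z of (w, a) \<Rightarrow> join k a w) \<notin> N"
    by (rule AE_distrD [OF measurable_join])
  from P.AE_pair [OF this] have *: "AE w in opp_lborel k. AE a in lborel. join k a w \<notin> N"
    by simp
  then show "AE w in opp_lborel k. AE a in lborel. P (join k a w)"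
    by eventually_elim (auto elim!: eventually_mono intro: NP)
  have [measurable]: "(\<lambda>z. join k (snd z) (fst z)) \<in> borel_measurable (opp_lborel k \<Otimes>\<^sub>M lborel)"
    using measurable_join [of k] by (simp only: case_prod_unfold)
  have "{z \<in> space (opp_lborel k \<Otimes>\<^sub>M lborel). join k (snd z) (fst z) \<notin> N}
      \<in> sets (opp_lborel k \<Otimes>\<^sub>M lborel)"
    by measurable
  from P.AE_commute [OF this] * have "AE a in lborel. AE w in opp_lborel k. join k a w \<notin> N"
    by simp
  then show "AE a in lborel. AE w in opp_lborel k. P (join k a w)"
    by eventually_elim (auto elim!: eventually_mono intro: NP)
qed

text \<open>Converse slicing. \<open>P\<close> is measurable here, so that null slices add up to a
  null set by Tonelli.\<close>

lemma AE_join_imp_AE_lborel: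
  fixes k :: "'n::finite"
  assumes P: "Measurable.pred borel P"
    and ae: "AE w in opp_lborel k. AE a in lborel. P (join k a w)"
  shows "AE u in lborel. P u"
proof -
  interpret P: pair_sigma_finite "opp_lborel k" "lborel :: real measure"
    by (rule pair_sigma_finite_opp_lborel)
  have meas: "{z \<in> space (opp_lborel k \<Otimes>\<^sub>M lborel). P (case z of (w, a) \<Rightarrow> join k a w)}
      \<in> sets (opp_lborel k \<Otimes>\<^sub>M lborel)"
    by (rule predE [OF measurable_compose [OF measurable_join P]])
  have "AE z in opp_lborel k \<Otimes>\<^sub>M lborel. P (case z of (w, a) \<Rightarrow> join k a w)"
    by (rule P.AE_pair_measure [OF meas]) (use ae in simp)
  then have "AE u in distr (opp_lborel k \<Otimes>\<^sub>M lborel) borel (\<lambda>(w, a). join k a w). P u"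
    using predE [OF P] by (subst AE_distr_iff [OF measurable_join]) simp_all
  then show ?thesis by (simp only: lborel_eq_distr_join [of k, symmetric])
qed

lemma measurable_opp [measurable]: "opp (k :: 'n::finite) \<in> measurable borel (opp_lborel k)"
  unfolding opp_def [abs_def] by (intro measurable_restrict) simp

text \<open>The cylinder over a null set of opponents' profiles is null.\<close>

lemma AE_opp_imp_AE_lborel:
  fixes k :: "'n::finite"
  assumes "AE w in opp_lborel k. Q w"
  shows "AE u in lborel. Q (opp k u)"
proof -
  obtain N where N: "N \<in> null_sets (opp_lborel k)" "{w \<in> space (opp_lborel k). \<not> Q w} \<subseteq> N"
    using assms by (auto simp: eventually_ae_filter)
  have [measurable]: "N \<in> sets (opp_lborel k)" using N by auto
  have "AE w in opp_lborel k. AE a in lborel. opp k (join k a w) \<notin> N"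
    using AE_not_in [OF N(1)] AE_space
    by eventually_elim (simp add: space_PiM PiE_def opp_join)
  then have "AE u in lborel. opp k u \<notin> N"
    by (intro AE_join_imp_AE_lborel) measurable
  then show ?thesis
  proof eventually_elim
    fix u :: "real ^ 'n" assume "opp k u \<notin> N"
    moreover have "opp k u \<in> space (opp_lborel k)"
      using measurable_space [OF measurable_opp, of u k] by simp
    ultimately show "Q (opp k u)" using N(2) by blast
  qed
qed

lemma AE_own_imp_AE_lborel:
  fixes k :: "'n::finite"
  assumes "AE a in lborel. Q a"
  shows "AE u in (lborel :: (real ^ 'n) measure). Q (u $ k)"
proof -
  obtain N where N: "N \<in> null_sets lborel" "\<And>a. a \<notin> N \<Longrightarrow> Q a"
    using assms AE_obtain_borel_cover by blast
  have [measurable]: "N \<in> sets borel" using N by auto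
  have "AE w in opp_lborel k. AE a in lborel. join k a w $ k \<notin> N"
    using AE_not_in [OF N(1)] by simp
  then have "AE u in (lborel :: (real ^ 'n) measure). u $ k \<notin> N"
    by (intro AE_join_imp_AE_lborel) measurable
  then show ?thesis
    by eventually_elim (rule N(2))
qed

section \<open>From almost everywhere to everywhere\<close>

text \<open>The points of \<open>S\<close> where \<open>f\<close> and \<open>g\<close> differ form
  an open set, and a nonempty open set is not null.\<close>

lemma continuous_AE_eq_imp_eq:
  fixes f g :: "'a::euclidean_space \<Rightarrow> real"
  assumes S: "open S" and cont: "continuous_on S f" "continuous_on S g"
    and ae: "AE u in lborel. u \<in> S \<longrightarrow> f u = g u" and x: "x \<in> S"
  shows "f x = g x"
proof (rule ccontr)
  assume ne: "f x \<noteq> g x"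
  define V where "V = (\<lambda>u. f u - g u) -` (- {0}) \<inter> S"
  have "open V" unfolding V_def
    using continuous_on_diff [OF cont] S by (metis continuous_on_open_vimage open_Compl closed_singleton)
  moreover have "x \<in> V" using ne x by (simp add: V_def)
  moreover obtain N where N: "N \<in> null_sets lborel" "\<And>u. u \<notin> N \<Longrightarrow> u \<in> S \<longrightarrow> f u = g u"
    using AE_obtain_borel_cover [OF ae] by blast
  then have "V \<subseteq> N" by (auto simp: V_def)
  moreover have "negligible N"
    using N(1) by (simp add: negligible_iff_null_sets null_sets_completionI)
  ultimately show False
    using open_not_negligible [of V] negligible_subset [of N V] by auto
qed

text \<open>If \<open>P\<close> failed throughout \<open>S\<close>, the constants 0 and 1 would
  agree almost everywhere on \<open>S\<close>. Used to pick a good own action in the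
  interior.\<close>

lemma AE_imp_ex_mem_open:
  fixes S :: "'a::euclidean_space set"
  assumes "open S" "S \<noteq> {}" "AE u in lborel. P u"
  shows "\<exists>u\<in>S. P u"
proof (rule ccontr)
  assume "\<not> ?thesis"
  with assms(3) have "AE u in lborel. u \<in> S \<longrightarrow> (0::real) = 1"
    by (auto elim: eventually_mono)
  then show False
    using continuous_AE_eq_imp_eq [OF assms(1), of "\<lambda>_. 0" "\<lambda>_. 1"] assms(2) by auto
qed

text \<open>Brook's replacement performed almost everywhere. The invariant is
  \<open>f = D + K\<close> with \<open>D\<close> differentiable and \<open>K\<close> blind to the
  coordinates in \<open>S\<close>; it starts from \<open>D = 0\<close>, \<open>K = f\<close> and
  ends with \<open>K\<close> constant.\<close>

lemma AE_additive_split_imp_differentiable: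
  fixes L :: "'n::finite \<Rightarrow> real ^ 'n \<Rightarrow> real" and f :: "real ^ 'n \<Rightarrow> real"
  assumes I: "open I" "I \<noteq> {}"
    and L: "\<And>k u. u \<in> profiles I \<Longrightarrow> L k differentiable (at u)"
    and split: "\<And>k. AE u in lborel. u \<in> profiles I \<longrightarrow> f u = L k u + M k (opp k u)"
  shows "\<exists>D c. (\<forall>u\<in>profiles I. D differentiable (at u)) \<and>
    (AE u in lborel. u \<in> profiles I \<longrightarrow> f u = D u + c)"
proof -
  have "\<exists>D K. (\<forall>u\<in>profiles I. D differentiable (at u)) \<and>
      (AE u in lborel. u \<in> profiles I \<longrightarrow> f u = D u + K u) \<and>
      (\<forall>j\<in>S. \<forall>u b. K (upd j b u) = K u)" if "finite S" for S
    using that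
  proof induction
    case empty
    then show ?case by (intro exI [of _ "\<lambda>_. 0"] exI [of _ f]) auto
  next
    case (insert k S)
    then obtain D K where
      D: "\<And>u. u \<in> profiles I \<Longrightarrow> D differentiable (at u)" and
      DK: "AE u in lborel. u \<in> profiles I \<longrightarrow> f u = D u + K u" and
      K: "\<And>j u b. j \<in> S \<Longrightarrow> K (upd j b u) = K u"
      by blast
    \<comment> \<open>Both representations of \<open>f\<close> hold on almost every slice, so one can choose the constant \<open>a\<close>
      that replaces coordinate \<open>k\<close> so that they hold at almost every \<open>upd k a u\<close>.\<close>
    have "AE u in lborel. u \<in> profiles I \<longrightarrow> f u = D u + K u \<and> f u = L k u + M k (opp k u)"
      using DK split [of k] by eventually_elim blast
    from AE_own_AE_opp [OF this, of k] obtain a where a: "a \<in> I" and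
      "AE w in opp_lborel k. join k a w \<in> profiles I \<longrightarrow> f (join k a w) = D (join k a w) + K (join k a w)
         \<and> f (join k a w) = L k (join k a w) + M k (opp k (join k a w))"
      using AE_imp_ex_mem_open [OF I] by meson
    from AE_opp_imp_AE_lborel [OF this(2)]
    have "AE u in lborel. upd k a u \<in> profiles I \<longrightarrow>
        f (upd k a u) = D (upd k a u) + K (upd k a u) \<and> f (upd k a u) = L k (upd k a u) + M k (opp k u)"
      by (simp add: join_opp)
    with split [of k] have "AE u in lborel. u \<in> profiles I \<longrightarrow>
        f u = D (upd k a u) + (L k u - L k (upd k a u)) + K (upd k a u)"
    proof (eventually_elim, intro impI)
      fix u :: "real ^ 'n"
      assume "u \<in> profiles I \<longrightarrow> f u = L k u + M k (opp k u)"
        and "upd k a u \<in> profiles I \<longrightarrow>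
          f (upd k a u) = D (upd k a u) + K (upd k a u) \<and> f (upd k a u) = L k (upd k a u) + M k (opp k u)"
        and u: "u \<in> profiles I"
      then show "f u = D (upd k a u) + (L k u - L k (upd k a u)) + K (upd k a u)"
        using upd_mem_profiles [OF u a, of k] by simp
    qed
    moreover have "(\<lambda>u. D (upd k a u) + (L k u - L k (upd k a u))) differentiable (at u)"
      if "u \<in> profiles I" for u
      by (intro differentiable_add differentiable_diff differentiable_compose_upd D L
          upd_mem_profiles that a)
    moreover have "K (upd k a (upd j b u)) = K (upd k a u)" if "j \<in> insert k S" for j u b
      using that K [of j b "upd k a u"] by (cases "j = k") (auto simp: upd_commute)
    ultimately show ?case
      by (intro exI [of _ "\<lambda>u. D (upd k a u) + (L k u - L k (upd k a u))"]
          exI [of _ "\<lambda>u. K (upd k a u)"] conjI ballI allI)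
  qed
  from this [OF finite, of UNIV] obtain D K where
    D: "\<forall>u\<in>profiles I. D differentiable (at u)" and
    DK: "AE u in lborel. u \<in> profiles I \<longrightarrow> f u = D u + K u" and
    K: "\<And>j u b. K (upd j b u) = K u"
    by blast
  \<comment> \<open>\<open>K\<close> ignores every coordinate on the whole space, so the base point
    0 may lie outside the box.\<close>
  have "K u = K 0" for u
    using const_along_all_imp_const [of UNIV K u 0] K by (simp add: const_along_def profiles_def)
  then have "AE u in lborel. u \<in> profiles I \<longrightarrow> f u = D u + K 0"
    using DK by (auto elim!: eventually_mono)
  with D show ?thesis by blast
qed

text \<open>Continuity enters twice. Along almost every slice it extends the equality from almost
  all to all own actions in \<open>I\<close>; then, for two fixed actions, it removes the
  exceptional opponents' profiles.\<close>

lemma AE_eq_opp_imp_const_along: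
  fixes R :: "real ^ 'n::finite \<Rightarrow> real"
  assumes I: "open I" and cont: "continuous_on (profiles I) R"
    and ae: "AE u in lborel. u \<in> profiles I \<longrightarrow> R u = M (opp k u)"
  shows "const_along I k R"
proof -
  have slice_cont: "continuous_on I (\<lambda>a. R (upd k a u))" if "u \<in> profiles I" for u
    by (rule continuous_on_compose2 [OF cont continuous_on_upd_value])
       (use upd_mem_profiles [OF that] in blast)
  have opp_cont: "continuous_on (profiles I) (\<lambda>u. R (upd k a u))" if "a \<in> I" for a
    by (rule continuous_on_compose2 [OF cont continuous_on_upd])
       (use upd_mem_profiles that in blast)
  have eq: "R (upd k a u) = R (upd k b u)" if a: "a \<in> I" and b: "b \<in> I" and u: "u \<in> profiles I" for a b u
  proof (rule continuous_AE_eq_imp_eq [OF open_profiles [OF I] opp_cont [OF a] opp_cont [OF b] _ u])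
    from AE_opp_imp_AE_lborel [OF AE_opp_AE_own [OF ae, of k]]
    have "AE u in lborel. AE c in lborel. upd k c u \<in> profiles I \<longrightarrow> R (upd k c u) = M (opp k u)"
      by (simp add: join_opp)
    then show "AE u in lborel. u \<in> profiles I \<longrightarrow> R (upd k a u) = R (upd k b u)"
    proof (eventually_elim, intro impI)
      fix u :: "real ^ 'n"
      assume ae: "AE c in lborel. upd k c u \<in> profiles I \<longrightarrow> R (upd k c u) = M (opp k u)"
        and u: "u \<in> profiles I"
      have "AE c in lborel. c \<in> I \<longrightarrow> R (upd k c u) = M (opp k u)"
        using ae by eventually_elim (use upd_mem_profiles [OF u] in blast)
      then have "R (upd k c u) = M (opp k u)" if "c \<in> I" for c
        by (rule continuous_AE_eq_imp_eq [OF I slice_cont [OF u] continuous_on_const _ that])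
      then show "R (upd k a u) = R (upd k b u)" using a b by simp
    qed
  qed
  show ?thesis
    unfolding const_along_def
  proof (intro ballI)
    fix u :: "real ^ 'n" and a assume "u \<in> profiles I" "a \<in> I"
    then show "R (upd k a u) = R u"
      using eq [of a "u $ k" u] by (simp add: profiles_def)
  qed
qed

section \<open>Conditional densities on a box with null boundary\<close>

lemma borel_profiles [measurable]:
  assumes [measurable]: "U \<in> sets borel"
  shows "(profiles U :: (real ^ 'n::finite) set) \<in> sets borel"
proof -
  have "{u \<in> space borel. \<forall>i. u $ i \<in> U} \<in> sets (borel :: (real ^ 'n) measure)"
    by measurable
  then show ?thesis by (simp add: profiles_def)
qed

text \<open>Isolates the measure-theoretic and smoothness properties of the responses. That the
  interior of \<open>U\<close> is a nonempty interval is derived when the locale is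
  interpreted.\<close>

locale conditional_densities =
  fixes U :: "real set" and q :: "'n::finite \<Rightarrow> real \<Rightarrow> ('n \<Rightarrow> real) \<Rightarrow> real"
  assumes borel_U: "U \<in> sets borel"
    and negligible_boundary: "negligible (U - interior U)"
    and convex_I: "convex (interior U)" and I_ne: "interior U \<noteq> {}"
    and density: "\<And>k. positive_conditional_density U k (q k)"
    and C2: "\<And>k. C2_on (profiles (interior U)) (\<lambda>u. q k (u $ k) (opp k u))"
begin

abbreviation I :: "real set" where "I \<equiv> interior U"

abbreviation B :: "(real ^ 'n) set" where "B \<equiv> profiles I"

abbreviation L :: "'n \<Rightarrow> real ^ 'n \<Rightarrow> real" where "L \<equiv> log_response q"

declare borel_U [measurable]

lemma I_borel [measurable]: "I \<in> sets borel"
  by simp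

lemma open_B: "open B"
  by (intro open_profiles open_interior)

lemma B_ne: "B \<noteq> {}"
proof -
  obtain a where "a \<in> I" using I_ne by blast
  then have "(\<chi> j. a) \<in> B" by (simp add: profiles_def)
  then show ?thesis by blast
qed

lemma B_subset: "B \<subseteq> profiles U"
  by (intro profiles_mono interior_subset)

lemma AE_own_interior: "AE a in lborel. a \<in> U \<longrightarrow> a \<in> I"
proof -
  have "U - I \<in> null_sets lborel"
    using negligible_boundary null_sets_completion_iff [of "U - I" lborel]
    by (simp add: negligible_iff_null_sets)
  from AE_not_in [OF this] show ?thesis by eventually_elim blast
qed

lemma AE_profiles_interior: "AE u in lborel. u \<in> profiles U \<longrightarrow> u \<in> B"
proof -
  have "AE u in (lborel :: (real ^ 'n) measure). \<forall>k. u $ k \<in> U \<longrightarrow> u $ k \<in> I"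
    by (subst AE_all_countable) (intro allI AE_own_imp_AE_lborel AE_own_interior)
  then show ?thesis by eventually_elim (simp add: profiles_def)
qed

text \<open>Slicing \<open>AE_profiles_interior\<close> at one suitable interior action
  \<open>a\<close> turns it into a statement about opponents' profiles.\<close>

lemma AE_opp_interior:
  fixes k :: 'n
  shows "AE w in opp_lborel k. w \<in> opp_profiles U k \<longrightarrow> w \<in> opp_profiles I k"
proof -
  obtain a where a: "a \<in> I" and
    "AE w in opp_lborel k. join k a w \<in> profiles U \<longrightarrow> join k a w \<in> B"
    using AE_imp_ex_mem_open [OF open_interior I_ne AE_own_AE_opp [OF AE_profiles_interior]] by blast
  from this(2) show ?thesis
  proof (eventually_elim, intro impI)
    fix w assume "join k a w \<in> profiles U \<longrightarrow> join k a w \<in> B" and w: "w \<in> opp_profiles U k"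
    then have "join k a w \<in> B"
      using join_mem_profiles [OF _ w] a interior_subset by blast
    from opp_mem_opp_profiles [OF this, of k] show "w \<in> opp_profiles I k"
      using opp_join [OF opp_profiles_extensional [OF w]] by simp
  qed
qed

lemma q_pos: "u \<in> B \<Longrightarrow> 0 < q k (u $ k) (opp k u)"
  using density [of k] opp_mem_opp_profiles [of u U k] B_subset
  unfolding positive_conditional_density_def by (auto simp: profiles_def)

lemma exp_L: "u \<in> B \<Longrightarrow> exp (L k u) = q k (u $ k) (opp k u)"
  by (simp add: log_response_def q_pos)

lemma C2_L: "C2_on B (L k)"
  unfolding log_response_def [abs_def] by (rule C2_on_ln [OF C2 q_pos])

lemma L_diff: "u \<in> B \<Longrightarrow> L k differentiable (at u)"
  by (rule C2_on_differentiable [OF open_B C2_L])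

lemma continuous_on_B: "(\<And>u. u \<in> B \<Longrightarrow> F differentiable (at u)) \<Longrightarrow> continuous_on B F"
  by (simp add: continuous_at_imp_continuous_on differentiable_imp_continuous_within)

lemma response_form_eq: "response_form q = coordinate_form L"
  by (simp add: fun_eq_iff response_form_def coordinate_form_def)

lemma interior_profiles_B: "interior (profiles U) = B"
  by (rule interior_profiles)

end

section \<open>Equilibria, product forms and potentials\<close>

context conditional_densities
begin

lemma slice_integral_cong:
  fixes \<psi> :: "real ^ 'n \<Rightarrow> real"
  assumes w: "w \<in> opp_profiles U k"
  shows "(LINT z:U|lborel. \<psi> (join k z w))
    = (\<integral>z. indicator (profiles U) (join k z w) *\<^sub>R \<psi> (join k z w) \<partial>lborel)"
proof -
  have "indicator (profiles U) (join k z w) = (indicator U z :: real)" for z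
    using w by (auto simp: profiles_def opp_profiles_def PiE_iff split: split_indicator)
  then show ?thesis by (simp add: set_lebesgue_integral_def)
qed

text \<open>The conditional identity is multiplied out on slices and then carried to the space of
  profiles by \<open>AE_join_imp_AE_lborel\<close>.\<close>

lemma equilibrium_AE_split:
  assumes ce: "conditional_equilibrium U q \<psi>"
  shows "AE u in lborel. u \<in> B \<longrightarrow>
    \<psi> u = q k (u $ k) (opp k u) * (LINT z:U|lborel. \<psi> (join k z (opp k u)))"
proof -
  \<comment> \<open>Cutting off by indicators (\<open>p\<close> here, \<open>r\<close> below) gives
    Borel functions on the whole space; \<open>\<psi>\<close> and the densities are controlled only
    on their sets.\<close>
  define p where "p u = indicator (profiles U) u *\<^sub>R \<psi> u" for u
  have p [measurable]: "p \<in> borel_measurable borel"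
    using ce unfolding conditional_equilibrium_def positive_joint_density_def set_integrable_def
      p_def [abs_def] by (auto dest: borel_measurable_integrable)
  define m where "m w = (\<integral>z. p (join k z w) \<partial>lborel)" for w
  have "(\<lambda>(w, z). p (join k z w)) \<in> borel_measurable (opp_lborel k \<Otimes>\<^sub>M lborel)"
    using measurable_compose [OF measurable_join p] by (simp add: case_prod_unfold)
  then have [measurable]: "m \<in> borel_measurable (opp_lborel k)"
    unfolding m_def [abs_def] by (rule lborel.borel_measurable_lebesgue_integral)
  define r where "r u = indicator B u *\<^sub>R q k (u $ k) (opp k u)" for u
  have "continuous_on B (\<lambda>u. q k (u $ k) (opp k u))"
    by (rule continuous_on_B) (rule C2_on_differentiable [OF open_B C2])
  then have [measurable]: "r \<in> borel_measurable borel"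
    unfolding r_def [abs_def] by (intro borel_measurable_continuous_on_indicator) auto
  have [measurable]: "B \<in> sets borel" by (rule borel_profiles [OF I_borel])
  have "AE u in lborel. u \<in> B \<longrightarrow> p u = r u * m (opp k u)"
  proof (rule AE_join_imp_AE_lborel [where k = k])
    have "AE w in opp_lborel k. w \<in> opp_profiles U k \<longrightarrow>
        (AE a in lborel. a \<in> U \<longrightarrow> full_conditional U \<psi> k a w = q k a w)"
      using ce by (simp add: conditional_equilibrium_def)
    with AE_space [of "opp_lborel k"]
    show "AE w in opp_lborel k. AE a in lborel. join k a w \<in> B \<longrightarrow>
      p (join k a w) = r (join k a w)
        * m (opp k (join k a w))"
    proof eventually_elim
      fix w
      assume ae: "w \<in> opp_profiles U k \<longrightarrow>
          (AE a in lborel. a \<in> U \<longrightarrow> full_conditional U \<psi> k a w = q k a w)"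
        and "w \<in> space (opp_lborel k)"
      then have opp: "opp k (join k a w) = w" for a
        by (simp add: space_PiM PiE_def opp_join)
      show "AE a in lborel. join k a w \<in> B \<longrightarrow>
        p (join k a w) = r (join k a w)
          * m (opp k (join k a w))"
      proof (cases "w \<in> opp_profiles U k")
        case True
        from ae True have "AE a in lborel. a \<in> U \<longrightarrow> full_conditional U \<psi> k a w = q k a w"
          by blast
        then show ?thesis
        proof (eventually_elim, intro impI)
          fix a assume *: "a \<in> U \<longrightarrow> full_conditional U \<psi> k a w = q k a w"
            and B: "join k a w \<in> B"
          have "join k a w $ k \<in> I" using B unfolding profiles_def by blast
          then have "a \<in> U" using interior_subset by auto
          with * have "\<psi> (join k a w) / m w = q k a w"
            by (simp add: full_conditional_def slice_integral_cong [OF True] m_def p_def)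
          moreover have "0 < q k a w"
            using q_pos [OF B, of k] by (simp add: opp)
          \<comment> \<open>If \<open>m w\<close> were 0, the quotient would be 0 by convention,
            against positivity of the density.\<close>
          ultimately have "\<psi> (join k a w) = q k a w * m w"
            by (cases "m w = 0") (auto simp: field_simps)
          then show "p (join k a w)
            = r (join k a w)
              * m (opp k (join k a w))"
            using B B_subset by (auto simp: p_def r_def opp)
        qed
      next
        case False
        have "join k a w \<notin> B" for a
          using opp_mem_opp_profiles [of "join k a w" U k] B_subset False opp by auto
        then show ?thesis by simp
      qed
    qed
  qed measurable
  then show ?thesis
  proof (eventually_elim, intro impI)
    fix u assume *: "u \<in> B \<longrightarrow> p u = r u * m (opp k u)"
      and u: "u \<in> B"
    have "u \<in> profiles U" using u B_subset by blast
    have "m (opp k u) = (LINT z:U|lborel. \<psi> (join k z (opp k u)))"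
      unfolding m_def p_def using slice_integral_cong [OF opp_mem_opp_profiles [OF \<open>u \<in> profiles U\<close>]]
      by (rule sym)
    with * u \<open>u \<in> profiles U\<close>
    show "\<psi> u = q k (u $ k) (opp k u) * (LINT z:U|lborel. \<psi> (join k z (opp k u)))"
      by (simp add: p_def r_def)
  qed
qed

text \<open>Logarithms make the splitting additive. The resulting \<open>D\<close> is
  differentiable, and \<open>D - L k\<close> is continuous and almost everywhere a function of the
  opponents' profile, hence exactly independent of coordinate \<open>k\<close>.\<close>

lemma equilibrium_imp_log_potential:
  assumes ce: "conditional_equilibrium U q \<psi>"
  shows "\<exists>D c. (\<forall>u\<in>B. D differentiable (at u)) \<and> (\<forall>k. const_along I k (\<lambda>u. D u - L k u)) \<and>
    (AE u in lborel. u \<in> B \<longrightarrow> \<psi> u = exp (D u + c))"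
proof -
  define M where "M k w = ln (LINT z:U|lborel. \<psi> (join k z w))" for k w
  have pos: "0 < \<psi> u" if "u \<in> B" for u
    using ce that B_subset by (auto simp: conditional_equilibrium_def positive_joint_density_def)
  have split: "AE u in lborel. u \<in> B \<longrightarrow> ln (\<psi> u) = L k u + M k (opp k u)" for k
    using equilibrium_AE_split [OF ce, of k]
  proof (eventually_elim, intro impI)
    fix u assume *: "u \<in> B \<longrightarrow>
        \<psi> u = q k (u $ k) (opp k u) * (LINT z:U|lborel. \<psi> (join k z (opp k u)))"
      and u: "u \<in> B"
    then have "0 < (LINT z:U|lborel. \<psi> (join k z (opp k u)))"
      using pos [OF u] q_pos [OF u, of k] by (simp add: zero_less_mult_iff)
    with * u show "ln (\<psi> u) = L k u + M k (opp k u)"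
      using q_pos [OF u, of k] by (simp add: M_def log_response_def ln_mult)
  qed
  obtain D c where D: "\<And>u. u \<in> B \<Longrightarrow> D differentiable (at u)"
    and Dc: "AE u in lborel. u \<in> B \<longrightarrow> ln (\<psi> u) = D u + c"
    using AE_additive_split_imp_differentiable [OF open_interior I_ne L_diff split] by blast
  have "const_along I k (\<lambda>u. D u - L k u)" for k
  proof (rule AE_eq_opp_imp_const_along [OF open_interior, where M = "\<lambda>w. M k w - c"])
    show "continuous_on B (\<lambda>u. D u - L k u)"
      by (intro continuous_on_diff continuous_on_B D L_diff)
    show "AE u in lborel. u \<in> B \<longrightarrow> D u - L k u = M k (opp k u) - c"
      using Dc split [of k] by eventually_elim auto
  qed
  moreover have "AE u in lborel. u \<in> B \<longrightarrow> \<psi> u = exp (D u + c)"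
    using Dc by eventually_elim (metis pos exp_ln)
  ultimately show ?thesis using D by blast
qed

text \<open>A nonnegative function with integral 0 vanishes almost everywhere, hence somewhere in
  the nonempty open box, where \<open>\<psi>\<close> is positive.\<close>

lemma integral_profiles_pos:
  fixes \<psi> :: "real ^ 'n \<Rightarrow> real"
  assumes pos: "\<And>u. u \<in> profiles U \<Longrightarrow> 0 < \<psi> u"
    and int: "set_integrable lborel (profiles U) \<psi>"
  shows "0 < (LINT u:profiles U|lborel. \<psi> u)"
proof -
  have nn: "AE u in lborel. 0 \<le> indicator (profiles U) u *\<^sub>R \<psi> u"
  proof (rule AE_I2)
    show "0 \<le> indicator (profiles U) u *\<^sub>R \<psi> u" for u
      using pos [of u] by (cases "u \<in> profiles U") auto
  qed
  have "(LINT u:profiles U|lborel. \<psi> u) \<noteq> 0"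
  proof
    assume "(LINT u:profiles U|lborel. \<psi> u) = 0"
    then have "AE u in lborel. indicator (profiles U) u *\<^sub>R \<psi> u = 0"
      using integral_nonneg_eq_0_iff_AE [OF int [unfolded set_integrable_def] nn]
      by (simp add: set_lebesgue_integral_def)
    from AE_imp_ex_mem_open [OF open_B B_ne this] obtain u where
      "u \<in> B" "indicator (profiles U) u *\<^sub>R \<psi> u = 0" by blast
    then show False using B_subset pos [of u] by auto
  qed
  moreover have "0 \<le> (LINT u:profiles U|lborel. \<psi> u)"
    unfolding set_lebesgue_integral_def by (rule integral_nonneg_AE [OF nn])
  ultimately show ?thesis by linarith
qed

text \<open>The part of \<open>profiles U\<close> outside \<open>B\<close> is null, so the value 1
  there preserves integrability while keeping the function positive and measurable.\<close>

lemma set_integrable_extend: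
  fixes F :: "real ^ 'n \<Rightarrow> real"
  assumes int: "set_integrable lborel (profiles U) \<psi>"
    and F: "(\<lambda>u. indicator B u *\<^sub>R F u) \<in> borel_measurable borel"
    and ae: "AE u in lborel. u \<in> B \<longrightarrow> \<psi> u = F u"
  shows "set_integrable lborel (profiles U) (\<lambda>u. if u \<in> B then F u else 1)"
proof -
  define h where "h u = indicator B u *\<^sub>R F u" for u
  have [measurable]: "h \<in> borel_measurable borel" unfolding h_def [abs_def] by (rule F)
  have [measurable]: "B \<in> sets borel" "(profiles U :: (real ^ 'n) set) \<in> sets borel"
    by (rule borel_profiles; simp)+
  have extend: "indicator (profiles U) u *\<^sub>R (if u \<in> B then F u else 1)
      = (if u \<in> B then h u else indicator (profiles U) u)" for u
    using B_subset by (auto simp: h_def split: split_indicator)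
  show ?thesis
    unfolding set_integrable_def extend
  proof (rule integrable_cong_AE_imp [OF int [unfolded set_integrable_def]])
    show "(\<lambda>u. if u \<in> B then h u else indicator (profiles U) u) \<in> borel_measurable lborel"
      by measurable
    show "AE u in lborel. indicator (profiles U) u *\<^sub>R \<psi> u
        = (if u \<in> B then h u else indicator (profiles U) u)"
      using ae AE_profiles_interior
    proof eventually_elim
      fix u assume "u \<in> B \<longrightarrow> \<psi> u = F u" "u \<in> profiles U \<longrightarrow> u \<in> B"
      then show "indicator (profiles U) u *\<^sub>R \<psi> u
          = (if u \<in> B then h u else indicator (profiles U) u)"
        unfolding extend [symmetric] by (cases "u \<in> profiles U") auto
    qed
  qed
qed

text \<open>Dividing by the total mass leaves the full conditionals unchanged, and profiles off the
  open box are negligible on almost every slice.\<close>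

lemma full_conditional_formula_imp_equilibrium:
  assumes pos: "\<And>u. u \<in> profiles U \<Longrightarrow> 0 < \<psi> u"
    and int: "set_integrable lborel (profiles U) \<psi>"
    and cond: "\<And>k u. u \<in> B \<Longrightarrow>
      q k (u $ k) (opp k u) = \<psi> u / (LINT z:U|lborel. \<psi> (join k z (opp k u)))"
  shows "\<exists>\<psi>. conditional_equilibrium U q \<psi>"
proof -
  define c where "c = (LINT u:profiles U|lborel. \<psi> u)"
  have c: "0 < c" unfolding c_def by (rule integral_profiles_pos [OF pos int])
  have "positive_joint_density U (\<lambda>u. \<psi> u / c)"
    using pos c int by (simp add: positive_joint_density_def c_def)
  moreover have "AE w in opp_lborel k. w \<in> opp_profiles U k \<longrightarrow>
      (AE a in lborel. a \<in> U \<longrightarrow> full_conditional U (\<lambda>u. \<psi> u / c) k a w = q k a w)" for k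
    using AE_opp_interior [of k]
  proof (eventually_elim, intro impI)
    fix w assume "w \<in> opp_profiles U k \<longrightarrow> w \<in> opp_profiles I k" "w \<in> opp_profiles U k"
    then have w: "w \<in> opp_profiles I k" by blast
    show "AE a in lborel. a \<in> U \<longrightarrow> full_conditional U (\<lambda>u. \<psi> u / c) k a w = q k a w"
      using AE_own_interior
    proof (eventually_elim, intro impI)
      fix a assume "a \<in> U \<longrightarrow> a \<in> I" "a \<in> U"
      then have "join k a w \<in> B" using join_mem_profiles [OF _ w] by blast
      from cond [OF this, of k] show "full_conditional U (\<lambda>u. \<psi> u / c) k a w = q k a w"
        using c by (simp add: full_conditional_def opp_join [OF opp_profiles_extensional [OF w]])
    qed
  qed
  ultimately show ?thesis unfolding conditional_equilibrium_def by blast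
qed

text \<open>Since \<open>q k\<close> integrates to one over own actions, the slice integral of the
  product is the factor \<open>\<phi> k\<close> itself.\<close>

lemma product_form_imp_full_conditional_formula:
  assumes \<phi>: "\<And>k w. w \<in> opp_profiles U k \<Longrightarrow> 0 < \<phi> k w"
    and prod: "\<And>k u. u \<in> B \<Longrightarrow> \<psi> u = q k (u $ k) (opp k u) * \<phi> k (opp k u)"
    and int: "set_integrable lborel (profiles U) \<psi>"
  shows "\<exists>\<psi>. (\<forall>u\<in>profiles U. 0 < \<psi> u) \<and> set_integrable lborel (profiles U) \<psi> \<and>
    (\<forall>k. \<forall>u\<in>B. q k (u $ k) (opp k u) = \<psi> u / (LINT z:U|lborel. \<psi> (join k z (opp k u))))"
proof (intro exI conjI ballI allI)
  \<comment> \<open>The given \<open>\<psi>\<close> is arbitrary off the open box, so its slices there need not be measurable.\<close>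
  let ?\<psi> = "\<lambda>u. if u \<in> B then \<psi> u else 1"
  have \<phi>_opp: "0 < \<phi> k (opp k u)" if "u \<in> B" for k u
    using \<phi> opp_mem_opp_profiles that B_subset by blast
  show "0 < ?\<psi> u" if "u \<in> profiles U" for u
    \<comment> \<open>\<open>undefined\<close> serves as an arbitrary player; any one factorization
      shows positivity.\<close>
    using prod [of u undefined] q_pos [of u undefined] \<phi>_opp [of u undefined] by simp
  have "(\<lambda>u. indicator (profiles U) u *\<^sub>R \<psi> u) \<in> borel_measurable borel"
    using int unfolding set_integrable_def by (auto dest: borel_measurable_integrable)
  then have "(\<lambda>u. indicator B u *\<^sub>R (indicator (profiles U) u *\<^sub>R \<psi> u)) \<in> borel_measurable borel"
    by (rule borel_measurable_scaleR [OF borel_measurable_indicator [OF borel_profiles [OF I_borel]]])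
  moreover have "(\<lambda>u. indicator B u *\<^sub>R (indicator (profiles U) u *\<^sub>R \<psi> u)) = (\<lambda>u. indicator B u *\<^sub>R \<psi> u)"
    using B_subset by (auto simp: fun_eq_iff split: split_indicator)
  ultimately have "(\<lambda>u. indicator B u *\<^sub>R \<psi> u) \<in> borel_measurable borel"
    by (simp only:)
  then show "set_integrable lborel (profiles U) ?\<psi>"
    by (rule set_integrable_extend [OF int]) simp
  fix k u assume u: "u \<in> B"
  let ?w = "opp k u"
  have wI: "?w \<in> opp_profiles I k" by (rule opp_mem_opp_profiles [OF u])
  have wU: "?w \<in> opp_profiles U k" using opp_mem_opp_profiles B_subset u by blast
  have B_iff: "upd k z u \<in> B \<longleftrightarrow> z \<in> I" for z
    using u by (auto simp: profiles_def)
  have qw: "set_integrable lborel U (\<lambda>a. q k a ?w)" "(LINT a:U|lborel. q k a ?w) = 1"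
    using density [of k] wU by (auto simp: positive_conditional_density_def)
  define h where "h z = indicator U z *\<^sub>R q k z ?w" for z
  have [measurable]: "h \<in> borel_measurable borel"
    using qw(1) unfolding set_integrable_def h_def [abs_def] by (auto dest: borel_measurable_integrable)
  \<comment> \<open>In this form the slice is visibly Borel, being assembled from the Borel function
    \<open>h\<close> and indicators.\<close>
  have slice: "indicator U z *\<^sub>R ?\<psi> (join k z ?w)
      = (if z \<in> I then h z * \<phi> k ?w else indicator U z)" for z
  proof (cases "z \<in> I")
    case True
    then have "upd k z u \<in> B" "z \<in> U" using B_iff interior_subset by auto
    then show ?thesis using True prod [of "upd k z u" k] by (simp add: join_opp h_def)
  next
    case False
    then have "upd k z u \<notin> B" using B_iff by simp
    with False show ?thesis by (simp add: join_opp)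
  qed
  have "(LINT z:U|lborel. ?\<psi> (join k z ?w)) = (LINT z:U|lborel. q k z ?w * \<phi> k ?w)"
    unfolding set_lebesgue_integral_def
  proof (rule integral_cong_AE)
    show "(\<lambda>z. indicator U z *\<^sub>R ?\<psi> (join k z ?w)) \<in> borel_measurable lborel"
      unfolding slice by measurable
    have "(\<lambda>z. h z * \<phi> k ?w) \<in> borel_measurable lborel" by measurable
    then show "(\<lambda>z. indicator U z *\<^sub>R (q k z ?w * \<phi> k ?w)) \<in> borel_measurable lborel"
      by (simp add: h_def mult.assoc)
    show "AE z in lborel. indicator U z *\<^sub>R ?\<psi> (join k z ?w) = indicator U z *\<^sub>R (q k z ?w * \<phi> k ?w)"
      unfolding slice using AE_own_interior by eventually_elim (auto simp: h_def split: split_indicator)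
  qed
  also have "\<dots> = \<phi> k ?w" using qw(2) by simp
  finally have "(LINT z:U|lborel. ?\<psi> (join k z ?w)) = \<phi> k ?w" .
  moreover have "q k (u $ k) ?w = ?\<psi> u / \<phi> k ?w"
    using prod [OF u, of k] \<phi>_opp [OF u, of k] u by simp
  ultimately show "q k (u $ k) ?w = ?\<psi> u / (LINT z:U|lborel. ?\<psi> (join k z ?w))"
    by (simp only:)
qed

text \<open>The factor for player \<open>k\<close> is \<open>exp (D u - L k u)\<close>, read off at
  a fixed own action \<open>a\<close> so that it depends on the opponents' profile only.\<close>

lemma const_along_imp_product_form:
  assumes "\<And>k. const_along I k (\<lambda>u. D u - L k u)"
  obtains \<phi> where "\<And>k w. 0 < \<phi> k w"
    "\<And>k u. u \<in> B \<Longrightarrow> exp (D u) = q k (u $ k) (opp k u) * \<phi> k (opp k u)"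
proof -
  obtain a where a: "a \<in> I" using I_ne by blast
  have "exp (D u) = q k (u $ k) (opp k u) * exp (D (join k a (opp k u)) - L k (join k a (opp k u)))"
    if u: "u \<in> B" for k u
    using const_alongD [OF assms u a, of k] q_pos [OF u, of k]
    by (simp add: join_opp exp_diff exp_L [OF u])
  then show ?thesis
    by (intro that [of "\<lambda>k w. exp (D (join k a w) - L k (join k a w))"]) auto
qed

lemma is_potential_iff_const_along:
  assumes "\<And>u. u \<in> B \<Longrightarrow> D differentiable (at u)"
  shows "is_potential U q D \<longleftrightarrow> (\<forall>k. const_along I k (\<lambda>u. D u - L k u))"
  using potential_iff_const_along [OF open_interior convex_I C2_L assms]
  by (simp add: is_potential_def interior_profiles_B response_form_eq)

lemma equilibrium_imp_normalizable_potential: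
  assumes ce: "conditional_equilibrium U q \<psi>"
  obtains \<Phi> where "is_potential U q \<Phi>" "normalizable U (\<lambda>u. exp (\<Phi> u))"
proof -
  obtain D c where D: "\<And>u. u \<in> B \<Longrightarrow> D differentiable (at u)"
    and const: "\<And>k. const_along I k (\<lambda>u. D u - L k u)"
    and eq: "AE u in lborel. u \<in> B \<longrightarrow> \<psi> u = exp (D u + c)"
    using equilibrium_imp_log_potential [OF ce] by blast
  \<comment> \<open>A potential is constrained only on the open box, but normalizability involves
    all of \<open>profiles U\<close>. The default 0 makes \<open>exp (\<Phi> u)\<close> equal to 1
    off the box, as in \<open>set_integrable_extend\<close>.\<close>
  define \<Phi> where "\<Phi> u = (if u \<in> B then D u + c else 0)" for u
  have \<Phi>_B: "D u + c = \<Phi> u" if "u \<in> B" for u using that by (simp add: \<Phi>_def)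
  have \<Phi>_diff: "\<Phi> differentiable (at u)" if u: "u \<in> B" for u
  proof -
    obtain D' where "((\<lambda>u. D u + c) has_derivative D') (at u)"
      using differentiable_add [OF D [OF u] differentiable_const] by (auto simp: differentiable_def)
    from has_derivative_transform_within_open [OF this open_B u \<Phi>_B] show ?thesis
      by (auto simp: differentiable_def)
  qed
  have "const_along I k (\<lambda>u. \<Phi> u - L k u)" for k
    using const [of k] by (auto simp: const_along_def \<Phi>_def upd_mem_profiles)
  then have "is_potential U q \<Phi>"
    using is_potential_iff_const_along [OF \<Phi>_diff] by blast
  moreover have "set_integrable lborel (profiles U) (\<lambda>u. exp (\<Phi> u))"
  proof -
    have "(\<lambda>u. indicator B u *\<^sub>R exp (D u + c)) \<in> borel_measurable borel"
      by (intro borel_measurable_continuous_on_indicator borel_profiles I_borel continuous_intros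
          continuous_on_B D)
    from set_integrable_extend [OF _ this eq] have
      "set_integrable lborel (profiles U) (\<lambda>u. if u \<in> B then exp (D u + c) else 1)"
      using ce by (simp add: conditional_equilibrium_def positive_joint_density_def)
    moreover have "(\<lambda>u. if u \<in> B then exp (D u + c) else 1) = (\<lambda>u. exp (\<Phi> u))"
      by (auto simp: fun_eq_iff \<Phi>_def)
    ultimately show ?thesis by simp
  qed
  ultimately show ?thesis
    using that integral_profiles_pos [of "\<lambda>u. exp (\<Phi> u)"] by (simp add: normalizable_def)
qed

lemma is_potential_differentiable: "is_potential U q \<Phi> \<Longrightarrow> u \<in> B \<Longrightarrow> \<Phi> differentiable (at u)"
  by (auto simp: is_potential_def interior_profiles_B differentiable_def)

lemma is_potential_imp_product_form:
  assumes "is_potential U q \<Phi>"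
  obtains \<phi> where "\<And>k w. 0 < \<phi> k w"
    "\<And>k u. u \<in> B \<Longrightarrow> exp (\<Phi> u) = q k (u $ k) (opp k u) * \<phi> k (opp k u)"
proof -
  have "const_along I k (\<lambda>u. \<Phi> u - L k u)" for k
    using assms is_potential_iff_const_along [OF is_potential_differentiable [OF assms]] by simp
  then show ?thesis by (rule const_along_imp_product_form) (rule that)
qed

lemma is_potential_imp_cross_partials:
  assumes "is_potential U q \<Phi>"
  shows "cross_partials_agree U q"
  unfolding cross_partials_agree_def interior_profiles_B
proof (intro allI impI ballI)
  fix i j :: 'n and u :: "real ^ 'n" assume "u \<in> B"
  then show "partial_deriv j (partial_deriv i (L i)) u = partial_deriv i (partial_deriv j (L j)) u"
    using assms
    by (intro potential_imp_cross_partials [OF open_interior convex_I C2_L, where \<Phi> = \<Phi>])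
      (simp_all add: is_potential_def interior_profiles_B response_form_eq)
qed

lemma cross_partials_imp_potential:
  assumes "cross_partials_agree U q"
  shows "\<exists>\<Phi>. is_potential U q \<Phi>"
proof -
  have "\<exists>\<Phi>. \<forall>u\<in>B. (\<Phi> has_derivative coordinate_form L u) (at u)"
  proof (rule potential_exists [OF open_interior convex_I C2_L I_ne])
    fix j k :: 'n and u :: "real ^ 'n" assume "j \<noteq> k" "u \<in> B"
    then show "partial_deriv j (partial_deriv k (L k)) u = partial_deriv k (partial_deriv j (L j)) u"
      using assms by (simp add: cross_partials_agree_def interior_profiles_B)
  qed
  then show ?thesis
    unfolding is_potential_def interior_profiles_B response_form_eq .
qed

section \<open>Uniqueness of the joint density\<close>

text \<open>The logarithms differ by a function independent of every coordinate, so the densities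
  are proportional almost everywhere; unit mass fixes the ratio \<open>r\<close> at 1.\<close>

lemma equilibrium_unique:
  assumes ce: "conditional_equilibrium U q \<psi>" and ce': "conditional_equilibrium U q \<psi>'"
  shows "AE u in lborel. u \<in> profiles U \<longrightarrow> \<psi>' u = \<psi> u"
proof -
  obtain D c where const: "\<And>k. const_along I k (\<lambda>u. D u - L k u)"
    and eq: "AE u in lborel. u \<in> B \<longrightarrow> \<psi> u = exp (D u + c)"
    using equilibrium_imp_log_potential [OF ce] by blast
  obtain D' c' where const': "\<And>k. const_along I k (\<lambda>u. D' u - L k u)"
    and eq': "AE u in lborel. u \<in> B \<longrightarrow> \<psi>' u = exp (D' u + c')"
    using equilibrium_imp_log_potential [OF ce'] by blast
  obtain v where v: "v \<in> B" using B_ne by blast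
  define r where "r = exp ((D' v - D v) + (c' - c))"
  have "const_along I k (\<lambda>u. D' u - D u)" for k
    unfolding const_along_def
  proof (intro ballI)
    fix u :: "real ^ 'n" and a assume "u \<in> B" "a \<in> I"
    then have "D (upd k a u) - L k (upd k a u) = D u - L k u"
      "D' (upd k a u) - L k (upd k a u) = D' u - L k u"
      by (rule const_alongD [OF const], rule const_alongD [OF const'])
    then show "D' (upd k a u) - D (upd k a u) = D' u - D u" by linarith
  qed
  then have diff: "D' u - D u = D' v - D v" if "u \<in> B" for u
    using const_along_all_imp_const [of I "\<lambda>u. D' u - D u" u v] that v by blast
  have ratio: "AE u in lborel. u \<in> profiles U \<longrightarrow> \<psi>' u = r * \<psi> u"
    using AE_profiles_interior eq eq'
  proof (eventually_elim, intro impI)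
    fix u assume "u \<in> profiles U \<longrightarrow> u \<in> B" "u \<in> B \<longrightarrow> \<psi> u = exp (D u + c)"
      "u \<in> B \<longrightarrow> \<psi>' u = exp (D' u + c')" "u \<in> profiles U"
    then have u: "u \<in> B" "\<psi> u = exp (D u + c)" "\<psi>' u = exp (D' u + c')" by blast+
    have "D' u + c' = ((D' v - D v) + (c' - c)) + (D u + c)"
      using diff [OF u(1)] by simp
    then show "\<psi>' u = r * \<psi> u"
      unfolding r_def u(2,3) by (metis exp_add)
  qed
  have int: "set_integrable lborel (profiles U) \<psi>" "set_integrable lborel (profiles U) \<psi>'"
    and one: "(LINT u:profiles U|lborel. \<psi> u) = 1" "(LINT u:profiles U|lborel. \<psi>' u) = 1"
    using ce ce' by (simp_all add: conditional_equilibrium_def positive_joint_density_def)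
  have "(LINT u:profiles U|lborel. \<psi>' u) = (LINT u:profiles U|lborel. r * \<psi> u)"
    unfolding set_lebesgue_integral_def
  proof (rule integral_cong_AE)
    show "AE u in lborel. indicator (profiles U) u *\<^sub>R \<psi>' u = indicator (profiles U) u *\<^sub>R (r * \<psi> u)"
      using ratio by eventually_elim (auto split: split_indicator)
    show "(\<lambda>u. indicator (profiles U) u *\<^sub>R \<psi>' u) \<in> borel_measurable lborel"
      using int(2) unfolding set_integrable_def by (rule borel_measurable_integrable)
    have "set_integrable lborel (profiles U) (\<lambda>u. r * \<psi> u)" using int(1) by simp
    then show "(\<lambda>u. indicator (profiles U) u *\<^sub>R (r * \<psi> u)) \<in> borel_measurable lborel"
      unfolding set_integrable_def by (rule borel_measurable_integrable)
  qed
  then have "r = 1" using one by simp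
  with ratio show ?thesis by simp
qed

end

section \<open>Equivalence and uniqueness for time-local responses\<close>

theorem theorem9:
  fixes T t :: real and U :: "real set" and x :: "real ^ 'n::finite"
    and b \<sigma> :: "'n \<Rightarrow> real \<Rightarrow> real ^ 'n \<Rightarrow> real ^ 'n \<Rightarrow> real"
    and f :: "'n \<Rightarrow> real \<Rightarrow> real ^ 'n \<Rightarrow> real \<Rightarrow> real"
    and g :: "'n \<Rightarrow> real ^ 'n \<Rightarrow> real"
    and \<beta> \<gamma> :: "'n \<Rightarrow> real"
    and v :: "'n \<Rightarrow> real \<Rightarrow> real ^ 'n \<Rightarrow> ('n \<Rightarrow> real) \<Rightarrow> real"
    and \<pi> :: "'n \<Rightarrow> real \<Rightarrow> ('n \<Rightarrow> real) \<Rightarrow> real"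
  assumes "T > 0"
    and "U \<in> sets borel" and "U \<noteq> {}" and "negligible (U - interior U)"
    and "\<And>k. (\<lambda>(s, y, u). b k s y u)
           \<in> borel_measurable (restrict_space borel ({0..T} \<times> UNIV \<times> profiles U))"
    and "\<And>k. (\<lambda>(s, y, u). \<sigma> k s y u)
           \<in> borel_measurable (restrict_space borel ({0..T} \<times> UNIV \<times> profiles U))"
    and "\<And>i. \<beta> i \<ge> 0" and "\<And>i. \<gamma> i > 0"
    and "\<And>i w. w \<in> opp_profiles U i \<Longrightarrow>
           classical_solution T U b \<sigma> f g \<beta> \<gamma> i w (\<lambda>s y. v i s y w)"
    and "t \<in> {0..T}"
    and "\<pi> = response U b \<sigma> f \<gamma> v t x"
    and "\<And>i. positive_conditional_density U i (\<pi> i)"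
    and "\<And>i. C2_on (interior (profiles U)) (\<lambda>u. \<pi> i (u $ i) (opp i u))"
    and "connected (interior (profiles U :: (real ^ 'n) set))"
    and "simply_connected (interior (profiles U :: (real ^ 'n) set))"
  shows "((\<exists>\<psi>. conditional_equilibrium U \<pi> \<psi>) \<longleftrightarrow>
      (\<exists>\<psi>. (\<forall>u\<in>profiles U. 0 < \<psi> u) \<and> set_integrable lborel (profiles U) \<psi> \<and>
        (\<forall>i. \<forall>u\<in>interior (profiles U).
          \<pi> i (u $ i) (opp i u) = \<psi> u / (LINT z:U|lborel. \<psi> (join i z (opp i u)))))) \<and>
    ((\<exists>\<psi>. conditional_equilibrium U \<pi> \<psi>) \<longleftrightarrow>
      (\<exists>\<phi> \<psi>. (\<forall>i. \<forall>w\<in>opp_profiles U i. 0 < \<phi> i w) \<and>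
        (\<forall>i. \<forall>u\<in>interior (profiles U). \<psi> u = \<pi> i (u $ i) (opp i u) * \<phi> i (opp i u)) \<and>
        normalizable U \<psi>)) \<and>
    ((\<exists>\<psi>. conditional_equilibrium U \<pi> \<psi>) \<longleftrightarrow>
      cross_partials_agree U \<pi> \<and>
      (\<exists>\<Phi>. is_potential U \<pi> \<Phi> \<and> normalizable U (\<lambda>u. exp (\<Phi> u)))) \<and>
    (cross_partials_agree U \<pi> \<longrightarrow> (\<exists>\<Phi>. is_potential U \<pi> \<Phi>)) \<and>
    ((\<exists>\<psi>. conditional_equilibrium U \<pi> \<psi>) \<longrightarrow>
      (\<exists>\<psi>. conditional_equilibrium U \<pi> \<psi> \<and>
        (\<forall>\<psi>'. conditional_equilibrium U \<pi> \<psi>' \<longrightarrow>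
          (AE u in lborel. u \<in> profiles U \<longrightarrow> \<psi>' u = \<psi> u))))"
proof -
  interpret conditional_densities U \<pi>
  proof
    have "connected (profiles (interior U) :: (real ^ 'n) set)"
      using assms(14) by (simp only: interior_profiles)
    then show "convex (interior U)"
      using connected_profilesD by (simp add: connected_convex_1)
    \<comment> \<open>With empty interior, \<open>U\<close> itself would be null and no density on
      it could have integral 1.\<close>
    show "interior U \<noteq> {}"
    proof
      assume "interior U = {}"
      with assms(4) have "negligible U" by simp
      then have "U \<in> null_sets lborel"
        using assms(2) null_sets_completion_iff [of U lborel] by (simp add: negligible_iff_null_sets)
      then have "(LINT a:U|lborel. h a) = 0" for h :: "real \<Rightarrow> real"
        unfolding set_lebesgue_integral_def
        by (intro integral_eq_zero_AE) (auto dest: AE_not_in elim!: eventually_mono)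
      moreover obtain a where "a \<in> U" using assms(3) by blast
      then have "(\<chi> j. a) \<in> (profiles U :: (real ^ 'n) set)" by (simp add: profiles_def)
      then have "opp k (\<chi> j. a) \<in> opp_profiles U k" for k :: 'n
        by (rule opp_mem_opp_profiles)
      ultimately show False
        using assms(12) unfolding positive_conditional_density_def by fastforce
    qed
    show "C2_on (profiles (interior U)) (\<lambda>u. \<pi> k (u $ k) (opp k u))" for k
      using assms(13) [of k] by (simp only: interior_profiles)
  qed (use assms(2,4,12) in auto)
  let ?ce = "\<exists>\<psi>. conditional_equilibrium U \<pi> \<psi>"
  let ?conditional = "\<exists>\<psi>. (\<forall>u\<in>profiles U. 0 < \<psi> u) \<and> set_integrable lborel (profiles U) \<psi> \<and>
    (\<forall>i. \<forall>u\<in>B. \<pi> i (u $ i) (opp i u) = \<psi> u / (LINT z:U|lborel. \<psi> (join i z (opp i u))))"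
  let ?product = "\<exists>\<phi> \<psi>. (\<forall>i. \<forall>w\<in>opp_profiles U i. 0 < \<phi> i w) \<and>
    (\<forall>i. \<forall>u\<in>B. \<psi> u = \<pi> i (u $ i) (opp i u) * \<phi> i (opp i u)) \<and> normalizable U \<psi>"
  let ?potential = "\<exists>\<Phi>. is_potential U \<pi> \<Phi> \<and> normalizable U (\<lambda>u. exp (\<Phi> u))"
  have conditional: ?ce if ?conditional
    using that full_conditional_formula_imp_equilibrium by blast
  have product: ?conditional if ?product
  proof -
    from that obtain \<phi> \<psi> where
      "\<And>i w. w \<in> opp_profiles U i \<Longrightarrow> 0 < \<phi> i w"
      "\<And>i u. u \<in> B \<Longrightarrow> \<psi> u = \<pi> i (u $ i) (opp i u) * \<phi> i (opp i u)"
      "set_integrable lborel (profiles U) \<psi>"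
      unfolding normalizable_def by blast
    then show ?thesis by (rule product_form_imp_full_conditional_formula)
  qed
  have potential: ?product if ?potential
  proof -
    from that obtain \<Phi> where \<Phi>: "is_potential U \<pi> \<Phi>" "normalizable U (\<lambda>u. exp (\<Phi> u))"
      by blast
    obtain \<phi> where "\<And>i w. 0 < \<phi> i w"
      "\<And>i u. u \<in> B \<Longrightarrow> exp (\<Phi> u) = \<pi> i (u $ i) (opp i u) * \<phi> i (opp i u)"
      using is_potential_imp_product_form [OF \<Phi>(1)] by blast
    with \<Phi>(2) show ?thesis
      by (intro exI [of _ \<phi>] exI [of _ "\<lambda>u. exp (\<Phi> u)"]) simp
  qed
  have ce: "cross_partials_agree U \<pi> \<and> ?potential" if ?ce
    using that equilibrium_imp_normalizable_potential is_potential_imp_cross_partials by meson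
  \<comment> \<open>The implications close a cycle: equilibrium, normalizable potential with
    cross-partials, product form, conditional formula, equilibrium.\<close>
  have "?ce \<longleftrightarrow> ?conditional" using conditional product potential ce by argo
  moreover have "?ce \<longleftrightarrow> ?product" using conditional product potential ce by argo
  moreover have "?ce \<longleftrightarrow> cross_partials_agree U \<pi> \<and> ?potential"
    using conditional product potential ce by argo
  moreover have "cross_partials_agree U \<pi> \<longrightarrow> (\<exists>\<Phi>. is_potential U \<pi> \<Phi>)"
    using cross_partials_imp_potential by blast
  moreover have "?ce \<longrightarrow> (\<exists>\<psi>. conditional_equilibrium U \<pi> \<psi> \<and>
      (\<forall>\<psi>'. conditional_equilibrium U \<pi> \<psi>' \<longrightarrow>
        (AE u in lborel. u \<in> profiles U \<longrightarrow> \<psi>' u = \<psi> u)))"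
    using equilibrium_unique by blast
  ultimately show ?thesis
    unfolding interior_profiles_B by (intro conjI)
qed

end
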